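(* Let $d\ge1$ and $\beta\ge0$, and let $\boldsymbol{X}=\{X_b\}_{b\in\mathbb{B}^d}$ be a collection of integrable real-valued random variables, indexed by the nearest-neighbor bonds of $\mathbb{Z}^d$, whose law $\mathbb{P}$ is translation-invariant and ergodic, with mean $\mathbb{E}[X_b]$ not depending on $b$. Then the quenched critical point $\hat h^{\mathsf q}_{\beta,\boldsymbol{X}}(x)$ is almost surely an $x$-independent constant; that is, there is a non-random constant $\hat h^{\mathsf q}_{\beta}$ such that, almost surely, $\hat h^{\mathsf q}_{\beta,\boldsymbol{X}}(x)=\hat h^{\mathsf q}_{\beta}$ for all $x\in\mathbb{Z}^d$. Moreover, writing $\hat h^{\mathsf q}_{\beta,\boldsymbol{X}}$ for $\hat h^{\mathsf q}_{\beta,\boldsymbol{X}}(x)$, \[ h_0-\beta\,\mathbb{E}[X_b]\;\le\;\hat h^{\mathsf q}_{\beta,\boldsymbol{X}}\;\le\;h^{\mathsf a}_\beta\qquad\text{almost surely}. \] For $d=1$, in particular, the lower bound is an equality: $\hat h^{\mathsf q}_{\beta,\boldsymbol{X}}=h_0-\beta\,\mathbb{E}[X_b]$ almost surely.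
   Context: $\mathbb{B}^d$ is the set of (undirected) nearest-neighbor bonds of $\mathbb{Z}^d$, so $X_{(u,v)}=X_{(v,u)}$. Translation invariance and ergodicity of $\mathbb{P}$ are with respect to the translations of $\mathbb{Z}^d$; $\mathbb{E}$ is expectation under $\mathbb{P}$. $\Omega(x)$ is the set of all finite nearest-neighbor self-avoiding paths $\omega=(\omega_0,\dots,\omega_n)$ on $\mathbb{Z}^d$ with $\omega_0=x$ and arbitrary endpoint; $|\omega|=n$ is the length of $\omega$ (length $0$ is allowed), and $b_j=b_j(\omega)=(\omega_{j-1},\omega_j)$ is its $j$-th bond. Let $c(n)$ be the number of $\omega\in\Omega(x)$ with $|\omega|=n$ (independent of $x$), $\mu=\lim_{n\to\infty}c(n)^{1/n}=\inf_n c(n)^{1/n}$ the connective constant, and $h_0=\log\mu$. For $h\in\mathbb{R}$ and $\beta\ge0$, the quenched susceptibility at $x\in\mathbb{Z}^d$ is \[ \hat\chi_{h,\beta,\boldsymbol{X}}(x)=\sum_{\omega\in\Omega(x)}e^{-\sum_{j=1}^{|\omega|}(h+\beta X_{b_j})}\in[0,\infty]. \] The quenched critical point at $x$ is $\hat h^{\mathsf q}_{\beta,\boldsymbol{X}}(x)=\inf\{h\in\mathbb{R}:\hat\chi_{h,\beta,\boldsymbol{X}}(x)<\infty\}$, and the annealed critical point is $h^{\mathsf a}_\beta=\inf\{h\in\mathbb{R}:\mathbb{E}[\hat\chi_{h,\beta,\boldsymbol{X}}(x)]<\infty\}$, which does not depend on $x$ by translation invariance. Both are extended-real valued, with $\inf\varnothing=+\infty$.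 *)

theory Defs
  imports "HOL-Probability.Probability"
begin

text \<open>The lattice of dimension \<open>d = CARD('d) \<ge> 1\<close> is the type \<open>int ^ 'd\<close>.\<close>

definition nearest_neighbor :: "int ^ 'd \<Rightarrow> int ^ 'd \<Rightarrow> bool" where
  "nearest_neighbor u v \<longleftrightarrow> (\<Sum>i\<in>UNIV. \<bar>u $ i - v $ i\<bar>) = 1"

text \<open>Undirected bonds are two-element sets, so a field indexed by bonds is automatically
  symmetric in the two endpoints.\<close>

definition bonds :: "(int ^ 'd) set set" where
  "bonds = {{u, v} | u v. nearest_neighbor u v}"

text \<open>The path \<open>(\<omega>\<^sub>0, \<dots>, \<omega>\<^sub>n)\<close> is the list of its \<open>n + 1\<close> vertices.\<close>

definition saws :: "int ^ 'd \<Rightarrow> (int ^ 'd) list set" where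
  "saws x = {\<omega>. \<omega> \<noteq> [] \<and> hd \<omega> = x \<and> distinct \<omega> \<and> successively nearest_neighbor \<omega>}"

definition path_length :: "'a list \<Rightarrow> nat" where
  "path_length \<omega> = length \<omega> - 1"

definition path_bond :: "'a list \<Rightarrow> nat \<Rightarrow> 'a set" where
  "path_bond \<omega> j = {\<omega> ! (j - 1), \<omega> ! j}"

definition saw_count :: "'d::finite itself \<Rightarrow> nat \<Rightarrow> nat" where
  "saw_count TYPE('d) n = card {\<omega> \<in> saws (0 :: int ^ 'd). path_length \<omega> = n}"

definition connective_constant :: "'d::finite itself \<Rightarrow> real" where
  "connective_constant TYPE('d) = lim (\<lambda>n. root n (real (saw_count TYPE('d) n)))"

definition h0 :: "'d::finite itself \<Rightarrow> real" where
  "h0 TYPE('d) = ln (connective_constant TYPE('d))"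

definition quenched_susceptibility ::
    "real \<Rightarrow> real \<Rightarrow> ((int ^ 'd) set \<Rightarrow> real) \<Rightarrow> int ^ 'd \<Rightarrow> ennreal" where
  "quenched_susceptibility h \<beta> X x =
    (\<Sum>\<^sub>\<infinity>\<omega>\<in>saws x. ennreal (exp (- (\<Sum>j = 1..path_length \<omega>. (h + \<beta> * X (path_bond \<omega> j))))))"

definition quenched_critical_point ::
    "real \<Rightarrow> ((int ^ 'd) set \<Rightarrow> real) \<Rightarrow> int ^ 'd \<Rightarrow> ereal" where
  "quenched_critical_point \<beta> X x =
    Inf (ereal ` {h. quenched_susceptibility h \<beta> X x < \<infinity>})"

definition annealed_critical_point ::
    "'w measure \<Rightarrow> real \<Rightarrow> ((int ^ 'd) set \<Rightarrow> 'w \<Rightarrow> real) \<Rightarrow> int ^ 'd \<Rightarrow> ereal" where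
  "annealed_critical_point M \<beta> X x =
    Inf (ereal ` {h. (\<integral>\<^sup>+ w. quenched_susceptibility h \<beta> (\<lambda>b. X b w) x \<partial>M) < \<infinity>})"

definition config_space :: "((int ^ 'd) set \<Rightarrow> real) measure" where
  "config_space = Pi\<^sub>M bonds (\<lambda>_. borel)"

definition field_law ::
    "'w measure \<Rightarrow> ((int ^ 'd) set \<Rightarrow> 'w \<Rightarrow> real) \<Rightarrow> ((int ^ 'd) set \<Rightarrow> real) measure" where
  "field_law M X = distr M config_space (\<lambda>w. \<lambda>b\<in>bonds. X b w)"

definition translate :: "int ^ 'd \<Rightarrow> ((int ^ 'd) set \<Rightarrow> real) \<Rightarrow> (int ^ 'd) set \<Rightarrow> real" where
  "translate z \<xi> = (\<lambda>b\<in>bonds. \<xi> ((+) z ` b))"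

definition translation_invariant :: "((int ^ 'd) set \<Rightarrow> real) measure \<Rightarrow> bool" where
  "translation_invariant P \<longleftrightarrow> (\<forall>z. distr P config_space (translate z) = P)"

text \<open>Ergodicity refers to the action of the whole translation group: only events invariant
  under \<^emph>\<open>all\<close> translations are required to be trivial.\<close>

definition translation_ergodic :: "((int ^ 'd) set \<Rightarrow> real) measure \<Rightarrow> bool" where
  "translation_ergodic P \<longleftrightarrow>
    (\<forall>A\<in>sets P. (\<forall>z. translate z -` A \<inter> space P = A) \<longrightarrow> measure P A = 0 \<or> measure P A = 1)"

end

theory Submission
  imports Defs
begin

text \<open>Cutting paths at a neighbouring site shows that finiteness of the susceptibility does not depend
  on the starting point; it is therefore a translation-invariant event, which has probability 0 or 1,
  and the critical point is a constant. The upper bound holds because a nonnegative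
  random variable of finite mean is almost surely finite. For the lower bound,
  Jensen's inequality compares the weight of all paths of length \<open>n\<close> with their number
  \<open>c(n) \<ge> \<mu>\<^sup>n\<close> times the exponential of their mean energy, whose expectation is
  \<open>n (h + \<beta> m)\<close>. In one dimension the paths are rays, and the maximal ergodic inequality
  controls the energy along a ray from below with positive probability, which suffices by the
  zero-one law.\<close>

section \<open>Infinite sums of extended nonnegative reals\<close>

text \<open>The field is merely integrable: it need not have exponential moments or a lower bound,
  so the expected susceptibility may be infinite and Fatou's lemma cannot be applied to the raw
  energies. Truncating the field from below at \<open>- K\<close> raises the energies, hence lowers
  the weights, and costs little in mean; the truncated energies are bounded below, as Fatou's lemma
  requires. Ergodicity is assumed for events that are invariant under every translation exactly, not
  just up to null sets. This is why finiteness of the susceptibility is shown to be independent of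
  the starting point in each fixed environment, and why the same is done for the sums over rays in
  dimension one. With positive probability, the maximal inequality keeps all partial sums along a
  ray above a line of slope slightly less than the mean; for \<open>h\<close> above
  \<open>- \<beta> * m\<close> the weights on the ray then decay geometrically.\<close>

lemma summable_on_ennreal [simp]: "(f :: 'a \<Rightarrow> ennreal) summable_on A"
  by (rule nonneg_summable_on_complete) simp

lemma infsum_ennreal_eq_SUP:
  fixes f :: "'a \<Rightarrow> ennreal"
  shows "infsum f A = (SUP F\<in>{F. finite F \<and> F \<subseteq> A}. sum f F)"
  by (rule nonneg_infsum_complete) simp

lemma finite_sum_le_infsum_ennreal:
  fixes f :: "'a \<Rightarrow> ennreal"
  assumes "finite F" "F \<subseteq> A"
  shows "sum f F \<le> infsum f A"
  unfolding infsum_ennreal_eq_SUP using assms by (intro SUP_upper) auto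

lemma infsum_ennreal_mono_set:
  fixes f :: "'a \<Rightarrow> ennreal"
  assumes "A \<subseteq> B"
  shows "infsum f A \<le> infsum f B"
  using assms by (intro infsum_mono_neutral) auto

lemma infsum_ennreal_Un_le:
  fixes f :: "'a \<Rightarrow> ennreal"
  shows "infsum f (A \<union> B) \<le> infsum f A + infsum f B"
proof -
  have "infsum f (A \<union> B) = infsum f (A \<union> (B - A))" by simp
  also have "\<dots> = infsum f A + infsum f (B - A)"
    by (rule infsum_Un_disjoint) auto
  also have "\<dots> \<le> infsum f A + infsum f B"
    by (intro add_left_mono infsum_ennreal_mono_set) auto
  finally show ?thesis .
qed

lemma borel_measurable_infsum_ennreal:
  fixes f :: "'a \<Rightarrow> 'b \<Rightarrow> ennreal"
  assumes "countable A" "\<And>a. a \<in> A \<Longrightarrow> f a \<in> borel_measurable M"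
  shows "(\<lambda>x. \<Sum>\<^sub>\<infinity>a\<in>A. f a x) \<in> borel_measurable M"
  unfolding infsum_ennreal_eq_SUP using assms
  by (intro borel_measurable_SUP countable_Collect_finite_subset borel_measurable_sum) auto

text \<open>Any \<open>k\<close> of the infinitely many good blocks form a finite subsum of at least
  \<open>k\<close>. Blocks that are good infinitely often are what the negation of an eventual bound
  supplies in \<open>lower_bound\<close>, where \<open>S n\<close> is the set of paths of length
  \<open>n\<close>.\<close>

lemma infsum_ennreal_eq_top:
  fixes f :: "'a \<Rightarrow> ennreal" and S :: "nat \<Rightarrow> 'a set"
  assumes fin: "\<And>n. finite (S n)" and sub: "\<And>n. S n \<subseteq> A"
    and disj: "\<And>m n. m \<noteq> n \<Longrightarrow> S m \<inter> S n = {}"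
    and freq: "\<exists>\<^sub>F n in sequentially. 1 \<le> sum f (S n)"
  shows "infsum f A = \<infinity>"
proof -
  have inf: "infinite {n. 1 \<le> sum f (S n)}"
    using freq by (simp add: cofinite_eq_sequentially [symmetric] frequently_cofinite)
  have "of_nat k \<le> infsum f A" for k
  proof -
    obtain I where I: "finite I" "card I = k" "I \<subseteq> {n. 1 \<le> sum f (S n)}"
      using inf infinite_arbitrarily_large by blast
    have "of_nat k = (\<Sum>n\<in>I. 1 :: ennreal)" using I by simp
    also have "\<dots> \<le> (\<Sum>n\<in>I. sum f (S n))" using I by (intro sum_mono) auto
    also have "\<dots> = sum f (\<Union>n\<in>I. S n)"
      using I fin disj by (intro sum.UNION_disjoint [symmetric]) auto
    also have "\<dots> \<le> infsum f A"
      using I fin sub by (intro finite_sum_le_infsum_ennreal) auto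
    finally show ?thesis .
  qed
  then show ?thesis
    by (metis ennreal_Ex_less_of_nat infinity_ennreal_def leD top.not_eq_extremum)
qed

section \<open>Self-avoiding paths\<close>

lemma nearest_neighbor_commute: "nearest_neighbor u v \<longleftrightarrow> nearest_neighbor v u"
  by (simp add: nearest_neighbor_def abs_minus_commute)

lemma nearest_neighbor_add [simp]: "nearest_neighbor (z + u) (z + v) \<longleftrightarrow> nearest_neighbor u v"
  by (simp add: nearest_neighbor_def)

lemma nearest_neighbor_diff: "nearest_neighbor u v \<longleftrightarrow> nearest_neighbor 0 (v - u)"
  by (simp add: nearest_neighbor_def abs_minus_commute)

lemma finite_neighbors: "finite {v :: int ^ 'd::finite. nearest_neighbor u v}"
proof -
  have "\<bar>v $ i\<bar> \<le> 1" if "nearest_neighbor 0 v" for v :: "int ^ 'd" and i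
    using that member_le_sum[of i UNIV "\<lambda>i. \<bar>v $ i\<bar>"] by (simp add: nearest_neighbor_def)
  then have "vec_nth v \<in> UNIV \<rightarrow>\<^sub>E {-1..1}" if "nearest_neighbor 0 v" for v :: "int ^ 'd"
    using that by (force simp: PiE_UNIV_domain abs_le_iff)
  then have "{v :: int ^ 'd. nearest_neighbor 0 v} \<subseteq> vec_lambda ` (UNIV \<rightarrow>\<^sub>E {-1..1})"
    by (metis (mono_tags, lifting) image_eqI mem_Collect_eq subsetI vec_nth_inverse)
  then have "finite {v :: int ^ 'd. nearest_neighbor 0 v}"
    by (rule finite_subset) (intro finite_imageI finite_PiE; simp)
  moreover have "{v. nearest_neighbor u v} = (+) u ` {v. nearest_neighbor 0 v}"
    by (force simp: image_iff nearest_neighbor_diff[of u])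
  ultimately show ?thesis by simp
qed

definition saws_of_length :: "nat \<Rightarrow> int ^ 'd \<Rightarrow> (int ^ 'd) list set" where
  "saws_of_length n x = {\<omega> \<in> saws x. path_length \<omega> = n}"

lemma saws_of_length_iff:
  "\<omega> \<in> saws_of_length n x \<longleftrightarrow>
    length \<omega> = Suc n \<and> hd \<omega> = x \<and> distinct \<omega> \<and> successively nearest_neighbor \<omega>"
  by (auto simp: saws_of_length_def saws_def path_length_def)

lemma saws_of_length_subset: "saws_of_length n x \<subseteq> saws x"
  by (auto simp: saws_of_length_def)

lemma saws_eq_Union: "saws x = (\<Union>n. saws_of_length n x)"
  by (auto simp: saws_of_length_def)

lemma finite_saws_of_length: "finite (saws_of_length n (x :: int ^ 'd::finite))"
proof (induction n arbitrary: x)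
  case 0
  have "saws_of_length 0 x \<subseteq> {[x]}"
    by (auto simp: saws_of_length_iff length_Suc_conv)
  then show ?case by (rule finite_subset) simp
next
  case (Suc n)
  have "saws_of_length (Suc n) x \<subseteq>
      (\<Union>y\<in>{y. nearest_neighbor x y}. (#) x ` saws_of_length n y)"
  proof
    fix \<omega> assume w: "\<omega> \<in> saws_of_length (Suc n) x"
    then obtain y \<omega>' where "\<omega> = x # y # \<omega>'"
      by (auto simp: saws_of_length_iff length_Suc_conv)
    then show "\<omega> \<in> (\<Union>y\<in>{y. nearest_neighbor x y}. (#) x ` saws_of_length n y)"
      using w by (intro UN_I[of y]) (auto simp: saws_of_length_iff)
  qed
  moreover have "finite \<dots>"
    using Suc finite_neighbors by blast
  ultimately show ?case by (rule finite_subset)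
qed

lemma countable_saws: "countable (saws (x :: int ^ 'd::finite))"
  unfolding saws_eq_Union by (simp add: countable_finite finite_saws_of_length)

lemma map_add_saws: "map ((+) z) \<omega> \<in> saws (z + x) \<longleftrightarrow> \<omega> \<in> saws x"
  by (auto simp: saws_def successively_map hd_map distinct_map)

lemma map_add_saws_of_length: "map ((+) z) \<omega> \<in> saws_of_length n (z + x) \<longleftrightarrow> \<omega> \<in> saws_of_length n x"
  by (auto simp: saws_of_length_def map_add_saws path_length_def)

lemma bij_betw_map_add_saws: "bij_betw (map ((+) z)) (saws x) (saws (z + x))"
proof (rule bij_betwI[where g = "map ((+) (-z))"])
  show "map ((+) (- z)) \<in> saws (z + x) \<rightarrow> saws x"
    using map_add_saws[of "-z" _ "z + x"] by auto
qed (auto simp: map_add_saws o_def)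

lemma path_length_map [simp]: "path_length (map g \<omega>) = path_length \<omega>"
  by (simp add: path_length_def)

lemma path_bond_map:
  "j \<in> {1..path_length \<omega>} \<Longrightarrow> path_bond (map g \<omega>) j = g ` path_bond \<omega> j"
  by (auto simp: path_bond_def path_length_def)

lemma path_bond_in_bonds:
  assumes "successively nearest_neighbor \<omega>" "j \<in> {1..path_length \<omega>}"
  shows "path_bond \<omega> j \<in> bonds"
proof -
  have "nearest_neighbor (\<omega> ! (j - 1)) (\<omega> ! j)"
    using assms successively_nth[OF assms(1), of "j - 1"] by (auto simp: path_length_def)
  then show ?thesis by (auto simp: bonds_def path_bond_def)
qed

text \<open>Kept general in \<open>f\<close>, so that the same algebra serves the energy
  \<open>h + \<beta> * X b\<close>, the field itself, its truncation and constants.\<close>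

definition path_sum :: "('a set \<Rightarrow> real) \<Rightarrow> 'a list \<Rightarrow> real" where
  "path_sum f \<omega> = (\<Sum>j = 1..path_length \<omega>. f (path_bond \<omega> j))"

lemma path_sum_singleton [simp]: "path_sum f [x] = 0"
  by (simp add: path_sum_def path_length_def)

lemma path_sum_Cons: "path_sum f (x # y # \<omega>) = f {x, y} + path_sum f (y # \<omega>)"
proof -
  have "path_sum f (x # y # \<omega>) = (\<Sum>j = 1..Suc (length \<omega>). f (path_bond (x # y # \<omega>) j))"
    by (simp add: path_sum_def path_length_def)
  also have "\<dots> = f (path_bond (x # y # \<omega>) 1) +
      (\<Sum>j = Suc 1..Suc (length \<omega>). f (path_bond (x # y # \<omega>) j))"
    by (rule sum.atLeast_Suc_atMost) simp
  also have "(\<Sum>j = Suc 1..Suc (length \<omega>). f (path_bond (x # y # \<omega>) j)) =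
      (\<Sum>j = 1..length \<omega>. f (path_bond (x # y # \<omega>) (Suc j)))"
    by (rule sum.shift_bounds_cl_Suc_ivl)
  also have "\<dots> = path_sum f (y # \<omega>)"
    unfolding path_sum_def path_length_def
    by (intro sum.cong) (auto simp: path_bond_def nth_Cons')
  finally show ?thesis by (simp add: path_bond_def)
qed

text \<open>The cut vertex \<open>x\<close> is repeated in both pieces, since otherwise the bond
  leading into it or out of it would be lost.\<close>

lemma path_sum_append: "path_sum f (\<omega> @ x # \<omega>') = path_sum f (\<omega> @ [x]) + path_sum f (x # \<omega>')"
proof (induction \<omega>)
  case (Cons y \<omega>)
  then show ?case by (cases \<omega>) (simp_all add: path_sum_Cons)
qed simp

text \<open>Bonds are unordered, so the direction of travel is immaterial. This allows the piece of
  a path before its visit to \<open>x\<close> to be read as a path from \<open>x\<close>.\<close>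

lemma path_sum_rev: "path_sum f (rev \<omega>) = path_sum f \<omega>"
proof (induction \<omega> rule: induct_list012)
  case (3 x y \<omega>)
  then show ?case
    by (simp add: path_sum_append[of f "rev \<omega>" y "[x]"] path_sum_Cons insert_commute)
qed simp_all

lemma path_sum_map: "path_sum f (map g \<omega>) = path_sum (\<lambda>b. f (g ` b)) \<omega>"
  unfolding path_sum_def by (simp add: path_bond_map)

lemma path_sum_cong:
  assumes "\<omega> \<in> saws x" "\<And>b. b \<in> bonds \<Longrightarrow> f b = g b"
  shows "path_sum f \<omega> = path_sum g \<omega>"
  unfolding path_sum_def
  using assms by (intro sum.cong) (auto simp: saws_def path_bond_in_bonds)

lemma path_sum_mono:
  assumes "\<omega> \<in> saws x" "\<And>b. b \<in> bonds \<Longrightarrow> f b \<le> g b"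
  shows "path_sum f \<omega> \<le> path_sum g \<omega>"
  unfolding path_sum_def
  using assms by (intro sum_mono) (auto simp: saws_def path_bond_in_bonds)

lemma path_sum_affine:
  "path_sum (\<lambda>b. h + \<beta> * f b) \<omega> = h * real (path_length \<omega>) + \<beta> * path_sum f \<omega>"
  by (simp add: path_sum_def sum.distrib sum_distrib_left)

lemma path_sum_const: "path_sum (\<lambda>b. c) \<omega> = c * real (path_length \<omega>)"
  by (simp add: path_sum_def)

section \<open>The susceptibility of a fixed environment\<close>

definition path_weight :: "('a set \<Rightarrow> real) \<Rightarrow> 'a list \<Rightarrow> ennreal" where
  "path_weight f \<omega> = ennreal (exp (- path_sum f \<omega>))"

lemma quenched_susceptibility_eq:
  "quenched_susceptibility h \<beta> X x = infsum (path_weight (\<lambda>b. h + \<beta> * X b)) (saws x)"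
  unfolding quenched_susceptibility_def path_weight_def path_sum_def ..

text \<open>Fields that agree on \<open>bonds\<close> may differ elsewhere, where restricted
  functions are \<open>undefined\<close>; this identifies their susceptibilities.\<close>

lemma quenched_susceptibility_cong:
  assumes "\<And>b. b \<in> bonds \<Longrightarrow> X b = Y b"
  shows "quenched_susceptibility h \<beta> X x = quenched_susceptibility h \<beta> Y x"
  unfolding quenched_susceptibility_eq path_weight_def
  using assms by (intro infsum_cong arg_cong[of _ _ ennreal] arg_cong[of _ _ exp]
      arg_cong[of _ _ uminus] path_sum_cong) auto

lemma quenched_susceptibility_antimono:
  assumes "h \<le> h'"
  shows "quenched_susceptibility h' \<beta> X x \<le> quenched_susceptibility h \<beta> X x"
  unfolding quenched_susceptibility_eq path_weight_def using assms
  by (intro infsum_mono) (auto intro!: ennreal_leI path_sum_mono)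

text \<open>Shifting paths by \<open>z\<close> is a bijection. The identity turns independence of
  the starting point into translation invariance.\<close>

lemma quenched_susceptibility_translate:
  "quenched_susceptibility h \<beta> (translate z \<xi>) x = quenched_susceptibility h \<beta> \<xi> (z + x)"
proof -
  have "quenched_susceptibility h \<beta> (translate z \<xi>) x =
      quenched_susceptibility h \<beta> (\<lambda>b. \<xi> ((+) z ` b)) x"
    by (intro quenched_susceptibility_cong) (simp add: translate_def)
  also have "\<dots> = (\<Sum>\<^sub>\<infinity>\<omega>\<in>saws x. path_weight (\<lambda>b. h + \<beta> * \<xi> b) (map ((+) z) \<omega>))"
    unfolding quenched_susceptibility_eq path_weight_def path_sum_map ..
  also have "\<dots> = quenched_susceptibility h \<beta> \<xi> (z + x)"
    unfolding quenched_susceptibility_eq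
    by (rule infsum_reindex_bij_betw[OF bij_betw_map_add_saws])
  finally show ?thesis .
qed

text \<open>A path from \<open>y\<close> avoiding \<open>x\<close> extends to a path from \<open>x\<close>; a path from \<open>y\<close> through \<open>x\<close> is cut
  at \<open>x\<close> into two paths from \<open>x\<close>, the first one reversed.\<close>

lemma infsum_path_weight_neighbor_le:
  fixes x y :: "int ^ 'd::finite"
  assumes nn: "nearest_neighbor x y"
  shows "infsum (path_weight f) (saws y) \<le>
    ennreal (exp (f {x, y})) * infsum (path_weight f) (saws x) + infsum (path_weight f) (saws x) ^ 2"
    (is "_ \<le> ?c * ?S + _")
  unfolding infsum_ennreal_eq_SUP[of _ "saws y"]
proof (rule SUP_least, clarify)
  fix F :: "(int ^ 'd) list set"
  assume fin: "finite F" and sub: "F \<subseteq> saws y"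
  define A where "A = {\<omega>\<in>F. x \<notin> set \<omega>}"
  define B where "B = {\<omega>\<in>F. x \<in> set \<omega>}"
  have fin': "finite A" "finite B" using fin by (auto simp: A_def B_def)
  have "sum (path_weight f) A \<le> ?c * ?S"
  proof -
    \<comment> \<open>The prepended bond contributes the factor \<open>exp (- f {x, y})\<close>,
      which \<open>?c\<close> cancels.\<close>
    have "path_weight f \<omega> = ?c * path_weight f (x # \<omega>)" if "\<omega> \<in> A" for \<omega>
    proof -
      have "\<omega> \<in> saws y" using that sub by (auto simp: A_def)
      then obtain \<omega>' where "\<omega> = y # \<omega>'"
        by (cases \<omega>) (auto simp: saws_def)
      then show ?thesis
        by (simp add: path_weight_def path_sum_Cons ennreal_mult [symmetric] mult_exp_exp)
    qed
    then have "sum (path_weight f) A = ?c * (\<Sum>\<omega>\<in>A. path_weight f (x # \<omega>))"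
      by (simp add: sum_distrib_left)
    also have "(\<Sum>\<omega>\<in>A. path_weight f (x # \<omega>)) = sum (path_weight f) ((#) x ` A)"
      by (subst sum.reindex) auto
    also have "\<dots> \<le> ?S"
      using fin' sub nn
      by (intro finite_sum_le_infsum_ennreal) (auto simp: A_def saws_def successively_Cons)
    finally show ?thesis by (simp add: mult_left_mono)
  qed
  moreover have "sum (path_weight f) B \<le> ?S ^ 2"
  proof -
    \<comment> \<open>Both pieces contain the cut vertex: \<open>p\<close> runs from
      \<open>x\<close> back to \<open>y\<close>, and \<open>q\<close> runs from \<open>x\<close> to
      the end of the path.\<close>
    define p where "p \<omega> = rev (takeWhile (\<lambda>v. v \<noteq> x) \<omega> @ [x])" for \<omega>
    define q where "q \<omega> = dropWhile (\<lambda>v. v \<noteq> x) \<omega>" for \<omega>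
    have decomp: "\<omega> = takeWhile (\<lambda>v. v \<noteq> x) \<omega> @ x # tl (q \<omega>)" "q \<omega> = x # tl (q \<omega>)"
      if "x \<in> set \<omega>" for \<omega>
    proof -
      have "q \<omega> \<noteq> []" using that by (auto simp: q_def dropWhile_eq_Nil_conv)
      moreover from this have "hd (q \<omega>) = x" using hd_dropWhile[of "\<lambda>v. v \<noteq> x" \<omega>] by (auto simp: q_def)
      ultimately show "q \<omega> = x # tl (q \<omega>)" by (metis list.collapse)
      then show "\<omega> = takeWhile (\<lambda>v. v \<noteq> x) \<omega> @ x # tl (q \<omega>)"
        by (metis q_def takeWhile_dropWhile_id)
    qed
    have weight: "path_weight f \<omega> = path_weight f (p \<omega>) * path_weight f (q \<omega>)" if "\<omega> \<in> B" for \<omega>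
    proof -
      have x: "x \<in> set \<omega>" using that by (simp add: B_def)
      have "path_sum f \<omega> = path_sum f (p \<omega>) + path_sum f (q \<omega>)"
        using path_sum_append[of f "takeWhile (\<lambda>v. v \<noteq> x) \<omega>" x "tl (q \<omega>)"] decomp[OF x]
        by (simp only: p_def path_sum_rev)
      then show ?thesis
        by (simp add: path_weight_def ennreal_mult [symmetric] mult_exp_exp)
    qed
    have saw: "p \<omega> \<in> saws x \<and> q \<omega> \<in> saws x" if "\<omega> \<in> B" for \<omega>
    proof -
      have x: "x \<in> set \<omega>" and w: "\<omega> \<in> saws y" using that sub by (auto simp: B_def)
      define a b where "a = takeWhile (\<lambda>v. v \<noteq> x) \<omega>" and "b = tl (q \<omega>)"
      have *: "\<omega> = a @ x # b" "q \<omega> = x # b" "p \<omega> = x # rev a"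
        using decomp[OF x] by (simp_all add: a_def b_def p_def)
      have "distinct (a @ x # b)" "successively nearest_neighbor (a @ x # b)"
        using w unfolding *(1) by (auto simp: saws_def)
      moreover have "successively nearest_neighbor (rev (a @ [x]))"
        using \<open>successively nearest_neighbor (a @ x # b)\<close> unfolding successively_rev
        by (simp add: nearest_neighbor_commute successively_append_iff)
      ultimately show ?thesis
        unfolding *(2,3) by (auto simp: saws_def successively_append_iff)
    qed
    have inj: "inj_on (\<lambda>\<omega>. (p \<omega>, q \<omega>)) B"
      by (rule inj_onI) (auto simp: p_def q_def, metis takeWhile_dropWhile_id)
    have "sum (path_weight f) B = (\<Sum>\<omega>\<in>B. (\<lambda>(a, b). path_weight f a * path_weight f b) (p \<omega>, q \<omega>))"
      using weight by simp
    also have "\<dots> = (\<Sum>(a, b)\<in>(\<lambda>\<omega>. (p \<omega>, q \<omega>)) ` B. path_weight f a * path_weight f b)"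
      using inj by (subst sum.reindex) (auto simp: o_def)
    \<comment> \<open>Not every pair need come from a path in \<open>B\<close>; the remaining pairs
      only add nonnegative terms.\<close>
    also have "\<dots> \<le> (\<Sum>(a, b)\<in>p ` B \<times> q ` B. path_weight f a * path_weight f b)"
      using fin' by (intro sum_mono2) auto
    also have "\<dots> = sum (path_weight f) (p ` B) * sum (path_weight f) (q ` B)"
      by (simp add: sum_product sum.cartesian_product)
    also have "\<dots> \<le> ?S * ?S"
      using fin' saw by (intro mult_mono finite_sum_le_infsum_ennreal) auto
    finally show ?thesis by (simp add: power2_eq_square)
  qed
  moreover have "sum (path_weight f) F = sum (path_weight f) A + sum (path_weight f) B"
    using fin by (subst sum.union_disjoint [symmetric]) (auto simp: A_def B_def intro!: sum.cong)
  ultimately show "sum (path_weight f) F \<le> ?c * ?S + ?S ^ 2"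
    by (simp add: add_mono)
qed

lemma quenched_susceptibility_neighbor_finite:
  fixes x y :: "int ^ 'd::finite"
  assumes "nearest_neighbor x y" "quenched_susceptibility h \<beta> X x < \<infinity>"
  shows "quenched_susceptibility h \<beta> X y < \<infinity>"
proof -
  let ?f = "\<lambda>b. h + \<beta> * X b"
  have "infsum (path_weight ?f) (saws x) < top"
    using assms(2) by (simp add: quenched_susceptibility_eq)
  then have "ennreal (exp (?f {x, y})) * infsum (path_weight ?f) (saws x) +
      infsum (path_weight ?f) (saws x) ^ 2 < top"
    by (simp add: ennreal_mult_less_top power_less_top_ennreal)
  then show ?thesis
    using infsum_path_weight_neighbor_le[OF assms(1), of ?f]
    by (simp add: quenched_susceptibility_eq le_less_trans)
qed

lemma lattice_connected:
  fixes x y :: "int ^ 'd::finite"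
  assumes step: "\<And>u v. nearest_neighbor u v \<Longrightarrow> P u \<Longrightarrow> P v" and "P x"
  shows "P y"
proof (induction "nat (\<Sum>i\<in>UNIV. \<bar>x $ i - y $ i\<bar>)" arbitrary: y)
  case 0
  then have "(\<Sum>i\<in>UNIV. \<bar>x $ i - y $ i\<bar>) = 0"
    by (simp add: order_antisym sum_nonneg)
  then have "x = y" by (subst (asm) sum_nonneg_eq_0_iff) (auto simp: vec_eq_iff)
  then show ?case using \<open>P x\<close> by simp
next
  case (Suc n)
  then have "x \<noteq> y" by auto
  then obtain k where k: "x $ k \<noteq> y $ k" by (auto simp: vec_eq_iff)
  \<comment> \<open>\<open>z\<close> is \<open>y\<close> moved one unit towards \<open>x\<close> in
    a coordinate where they differ, so it is a neighbor of \<open>y\<close> at distance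
    \<open>n\<close> from \<open>x\<close>.\<close>
  define z where "z = (\<chi> i. if i = k then y $ k + sgn (x $ k - y $ k) else y $ i)"
  have nn: "nearest_neighbor z y"
    using k by (simp add: nearest_neighbor_def z_def if_distrib[of abs] abs_sgn_eq
        if_distribR if_distrib[of "\<lambda>u. u - _"] sum.delta cong: if_cong)
  have "(\<Sum>i\<in>UNIV. \<bar>x $ i - y $ i\<bar>) = \<bar>x $ k - y $ k\<bar> + (\<Sum>i\<in>UNIV - {k}. \<bar>x $ i - y $ i\<bar>)"
    by (simp add: sum.remove)
  moreover have "(\<Sum>i\<in>UNIV. \<bar>x $ i - z $ i\<bar>) = \<bar>x $ k - z $ k\<bar> + (\<Sum>i\<in>UNIV - {k}. \<bar>x $ i - z $ i\<bar>)"
    by (simp add: sum.remove)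
  moreover have "(\<Sum>i\<in>UNIV - {k}. \<bar>x $ i - z $ i\<bar>) = (\<Sum>i\<in>UNIV - {k}. \<bar>x $ i - y $ i\<bar>)"
    by (intro sum.cong) (auto simp: z_def)
  moreover have "\<bar>x $ k - z $ k\<bar> = \<bar>x $ k - y $ k\<bar> - 1"
    using k by (simp add: z_def sgn_if)
  ultimately have "n = nat (\<Sum>i\<in>UNIV. \<bar>x $ i - z $ i\<bar>)"
    using Suc.hyps(2) by linarith
  then show ?case using Suc.hyps(1) step nn by blast
qed

lemma quenched_susceptibility_finite_iff:
  fixes x y :: "int ^ 'd::finite"
  shows "quenched_susceptibility h \<beta> X x < \<infinity> \<longleftrightarrow> quenched_susceptibility h \<beta> X y < \<infinity>"
  using lattice_connected[of "\<lambda>x. quenched_susceptibility h \<beta> X x < \<infinity>"]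
    quenched_susceptibility_neighbor_finite by blast

section \<open>The connective constant\<close>

text \<open>Division with remainder by a nearly optimal \<open>p\<close> bounds \<open>a n\<close>
  by \<open>n / p * a p\<close> plus a bounded term. The limit is the infimum of
  \<open>a n / n\<close>, which gives the bound valid for every single \<open>n\<close>.\<close>

lemma Fekete_subadditive:
  fixes a :: "nat \<Rightarrow> real"
  assumes sub: "\<And>m n. a (m + n) \<le> a m + a n" and nonneg: "\<And>n. 0 \<le> a n"
  shows "\<exists>L. (\<lambda>n. a n / n) \<longlonglongrightarrow> L \<and> (\<forall>n. n * L \<le> a n)"
proof -
  define L where "L = (INF n\<in>{1..}. a n / real n)"
  have bdd: "bdd_below ((\<lambda>n. a n / real n) ` {1..})"
    using nonneg by (intro bdd_belowI2[of _ 0]) auto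
  have lower: "L \<le> a n / n" if "n \<ge> 1" for n
    unfolding L_def using that bdd by (intro cINF_lower) auto
  have mult: "a (q * p + r) \<le> q * a p + a r" for p q r
  proof (induction q)
    case (Suc q)
    have "a (Suc q * p + r) = a (p + (q * p + r))" by (simp add: algebra_simps)
    also have "\<dots> \<le> a p + a (q * p + r)" by (rule sub)
    finally show ?case using Suc by (simp add: algebra_simps)
  qed simp
  have "(\<lambda>n. a n / n) \<longlonglongrightarrow> L"
  proof (rule LIMSEQ_I)
    fix e :: real assume e: "0 < e"
    have "\<exists>n\<in>{1..}. a n / real n < L + e / 2"
      using e bdd unfolding L_def by (subst cINF_less_iff [symmetric]) auto
    then obtain p where p: "p \<ge> 1" "a p / real p < L + e / 2" by auto
    \<comment> \<open>A common bound for \<open>a\<close> at all remainders modulo \<open>p\<close>;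
      its share \<open>C / n\<close> vanishes in the limit.\<close>
    define C where "C = (\<Sum>r<p. a r)"
    have C: "a r \<le> C" if "r < p" for r
      unfolding C_def using that nonneg by (intro member_le_sum) auto
    have upper: "a n / n \<le> a p / p + C / n" if "n \<ge> 1" for n
    proof -
      have "a n \<le> (n div p) * a p + a (n mod p)"
        using mult[of "n div p" p "n mod p"] by simp
      also have "a (n mod p) \<le> C" using p by (intro C) simp
      also have "real (n div p) \<le> n / p" by (rule of_nat_div_le_of_nat)
      finally have "a n \<le> n / p * a p + C" using nonneg[of p] by (simp add: mult_right_mono)
      then show ?thesis using that p by (simp add: field_simps)
    qed
    have "(\<lambda>n. C / real n) \<longlonglongrightarrow> 0" by (rule lim_const_over_n)
    then have "\<forall>\<^sub>F n in sequentially. C / real n < e / 2"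
      using e by (intro order_tendstoD) auto
    then obtain N where N: "\<And>n. n \<ge> N \<Longrightarrow> C / real n < e / 2"
      by (auto simp: eventually_sequentially)
    show "\<exists>N. \<forall>n\<ge>N. norm (a n / n - L) < e"
    proof (intro exI allI impI)
      fix n assume n: "n \<ge> max N 1"
      then have "L \<le> a n / n" "a n / n \<le> a p / p + C / n" "C / n < e / 2"
        using lower[of n] upper[of n] N[of n] by simp_all
      then show "norm (a n / n - L) < e"
        unfolding real_norm_def abs_less_iff using p(2) e by linarith
    qed
  qed
  moreover have "n * L \<le> a n" for n
    using lower[of n] nonneg[of 0] by (cases "n = 0") (simp_all add: field_simps)
  ultimately show ?thesis by blast
qed

lemma card_saws_of_length: "card (saws_of_length n (x :: int ^ 'd::finite)) = saw_count TYPE('d) n"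
proof -
  have "bij_betw (map ((+) x)) (saws_of_length n 0) (saws_of_length n x)"
  proof (rule bij_betwI[where g = "map ((+) (-x))"])
    show "map ((+) x) \<in> saws_of_length n 0 \<rightarrow> saws_of_length n x"
      using map_add_saws_of_length[of x _ n 0] by simp
    show "map ((+) (- x)) \<in> saws_of_length n x \<rightarrow> saws_of_length n 0"
      using map_add_saws_of_length[of "-x" _ n x] by auto
  qed (auto simp: o_def)
  then show ?thesis
    by (simp add: bij_betw_same_card saw_count_def saws_of_length_def)
qed

text \<open>A path is cut at its vertex \<open>m\<close> and the second piece is moved to the
  origin. The pieces overlap in that vertex, so the first one records the shift and the cutting is
  injective.\<close>

lemma saw_count_add_le:
  "saw_count TYPE('d::finite) (m + n) \<le> saw_count TYPE('d) m * saw_count TYPE('d) n"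
proof -
  define g :: "(int ^ 'd) list \<Rightarrow> _" where
    "g \<omega> = (take (Suc m) \<omega>, map ((+) (- (\<omega> ! m))) (drop m \<omega>))" for \<omega>
  have "inj_on g (saws_of_length (m + n) 0)"
  proof (rule inj_onI)
    fix \<omega> \<omega>' assume w: "\<omega> \<in> saws_of_length (m + n) 0" "\<omega>' \<in> saws_of_length (m + n) 0"
      and eq: "g \<omega> = g \<omega>'"
    have take: "take (Suc m) \<omega> = take (Suc m) \<omega>'" using eq by (simp add: g_def)
    then have "take (Suc m) \<omega> ! m = take (Suc m) \<omega>' ! m" by simp
    then have nth: "\<omega> ! m = \<omega>' ! m" by simp
    have "inj ((+) (- (\<omega> ! m)))" by simp
    then have "drop m \<omega> = drop m \<omega>'"
      using eq nth inj_map_eq_map by (auto simp: g_def)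
    moreover have "take m \<omega> = take m \<omega>'"
      using take by (metis lessI less_imp_le min.absorb1 take_take)
    ultimately show "\<omega> = \<omega>'" by (metis append_take_drop_id)
  qed
  moreover have "g ` saws_of_length (m + n) 0 \<subseteq> saws_of_length m 0 \<times> saws_of_length n 0"
  proof (clarsimp simp: g_def, intro conjI)
    fix \<omega> :: "(int ^ 'd) list" assume w: "\<omega> \<in> saws_of_length (m + n) 0"
    have succ: "successively nearest_neighbor (take k \<omega> @ drop k \<omega>)" for k
      using w by (simp add: saws_of_length_iff)
    have "successively nearest_neighbor (take k \<omega>)" "successively nearest_neighbor (drop k \<omega>)" for k
      using succ[of k] by (simp_all only: successively_append_iff)
    then show "take (Suc m) \<omega> \<in> saws_of_length m 0"
      using w by (auto simp: saws_of_length_iff)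
    have "drop m \<omega> \<in> saws_of_length n (\<omega> ! m)"
      using w \<open>\<And>k. successively nearest_neighbor (drop k \<omega>)\<close>
      by (auto simp: saws_of_length_iff hd_drop_conv_nth)
    then show "map ((+) (- (\<omega> ! m))) (drop m \<omega>) \<in> saws_of_length n 0"
      using map_add_saws_of_length[of "- (\<omega> ! m)" _ n "\<omega> ! m"] by simp
  qed
  ultimately have "card (saws_of_length (m + n) (0 :: int ^ 'd)) \<le>
      card (saws_of_length m (0 :: int ^ 'd) \<times> saws_of_length n (0 :: int ^ 'd))"
    by (intro card_inj_on_le[of g] finite_cartesian_product finite_saws_of_length)
  then show ?thesis by (simp add: card_cartesian_product card_saws_of_length)
qed

text \<open>The straight path of \<open>n\<close> steps \<open>e\<close>. It witnesses that paths of
  every length exist, and in dimension one every path has this form.\<close>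

definition ray :: "int ^ 'd \<Rightarrow> int ^ 'd \<Rightarrow> nat \<Rightarrow> (int ^ 'd) list" where
  "ray x e n = map (\<lambda>j. x + int j *s e) [0..<Suc n]"

lemma ray_0 [simp]: "ray x e 0 = [x]"
  by (simp add: ray_def)

lemma ray_Suc: "ray x e (Suc n) = x # ray (x + e) e n"
  unfolding ray_def
  by (simp add: upt_rec[of 0 "Suc (Suc n)"] map_Suc_upt [symmetric] o_def vector_sadd_rdistrib
      add.assoc del: upt_Suc)

lemma hd_ray [simp]: "hd (ray x e n) = x"
  by (cases n) (simp_all add: ray_Suc)

lemma length_ray [simp]: "length (ray x e n) = Suc n"
  by (simp add: ray_def)

lemma ray_in_saws_of_length:
  fixes e :: "int ^ 'd::finite"
  assumes "nearest_neighbor 0 e"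
  shows "ray x e n \<in> saws_of_length n x"
proof -
  have "e \<noteq> 0" using assms by (auto simp: nearest_neighbor_def)
  then obtain k where "e $ k \<noteq> 0" by (auto simp: vec_eq_iff)
  then have "distinct (ray x e n)"
    by (auto simp: ray_def distinct_map inj_on_def vec_eq_iff simp del: upt_Suc)
  moreover have "successively nearest_neighbor (ray x e n)"
  proof (induction n arbitrary: x)
    case (Suc n)
    have "nearest_neighbor (x + 0) (x + e)"
      using assms by (simp only: nearest_neighbor_add)
    moreover have "ray (x + e) e n \<noteq> []" by (metis length_ray list.size(3) nat.distinct(1))
    ultimately show ?case using Suc by (simp add: ray_Suc successively_Cons)
  qed simp
  ultimately show ?thesis by (simp add: saws_of_length_iff)
qed

lemma nearest_neighbor_axis: "nearest_neighbor 0 (axis k 1 :: int ^ 'd::finite)"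
  by (simp add: nearest_neighbor_def axis_def if_distrib[of abs] cong: if_cong)

lemma saw_count_pos: "1 \<le> saw_count TYPE('d::finite) n"
proof -
  have "saws_of_length n (0 :: int ^ 'd) \<noteq> {}"
    using ray_in_saws_of_length[OF nearest_neighbor_axis] by blast
  then have "card (saws_of_length n (0 :: int ^ 'd)) \<noteq> 0"
    using finite_saws_of_length by (metis card_0_eq)
  then show ?thesis by (simp add: card_saws_of_length)
qed

text \<open>Fekete's lemma for the logarithm of the counts. Convergence has to come first, because
  \<open>lim\<close> in the definition is a choice operator; that the limit is an infimum gives the
  second claim.\<close>

lemma connective_constant_limit:
  shows "(\<lambda>n. root n (real (saw_count TYPE('d::finite) n))) \<longlonglongrightarrow> connective_constant TYPE('d)"
    and exp_h0_le_saw_count: "exp (real n * h0 TYPE('d)) \<le> real (saw_count TYPE('d) n)"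
proof -
  define c where "c n = real (saw_count TYPE('d) n)" for n
  have pos: "1 \<le> c n" for n using saw_count_pos by (simp add: c_def)
  have "ln (c (m + n)) \<le> ln (c m) + ln (c n)" for m n
  proof -
    have "c (m + n) \<le> c m * c n"
      using saw_count_add_le[of m n] unfolding c_def of_nat_mult [symmetric] of_nat_le_iff .
    then have "ln (c (m + n)) \<le> ln (c m * c n)"
      using pos[of "m + n"] pos[of m] pos[of n] by (subst ln_le_cancel_iff) (auto intro!: mult_pos_pos)
    then show ?thesis using pos[of m] pos[of n] by (simp add: ln_mult)
  qed
  moreover have "0 \<le> ln (c n)" for n using pos[of n] by simp
  ultimately obtain L where L: "(\<lambda>n. ln (c n) / n) \<longlonglongrightarrow> L" "\<And>n. n * L \<le> ln (c n)"
    using Fekete_subadditive[of "\<lambda>n. ln (c n)"] by blast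
  have "(\<lambda>n. exp (ln (c n) / n)) \<longlonglongrightarrow> exp L"
    using L(1) by (rule tendsto_exp)
  \<comment> \<open>The two sides differ at \<open>n = 0\<close>, where \<open>root 0\<close> is 0
    and the left side is 1.\<close>
  moreover have "\<forall>\<^sub>F n in sequentially. exp (ln (c n) / n) = root n (c n)"
    using eventually_gt_at_top[of 0]
  proof eventually_elim
    case (elim n)
    then show ?case using pos[of n] by (simp add: root_powr_inverse powr_def)
  qed
  ultimately have lim: "(\<lambda>n. root n (c n)) \<longlonglongrightarrow> exp L"
    by (rule Lim_transform_eventually)
  then have "connective_constant TYPE('d) = exp L"
    unfolding connective_constant_def c_def by (rule limI)
  with lim L(2)[of n] pos[of n]
  show "(\<lambda>n. root n (real (saw_count TYPE('d) n))) \<longlonglongrightarrow> connective_constant TYPE('d)"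
    "exp (real n * h0 TYPE('d)) \<le> real (saw_count TYPE('d) n)"
    by (simp_all add: h0_def c_def ln_ge_iff)
qed

section \<open>The maximal ergodic inequality\<close>

text \<open>Garsia's argument: \<open>N k\<close> is the maximum of \<open>0\<close> and of the first \<open>k\<close> ergodic sums of \<open>f\<close>, and
  \<open>N (Suc k) - N k \<circ> T\<close> has nonnegative integral but is at most \<open>f\<close> on \<open>{N (Suc k) > 0}\<close> and at most
  \<open>0\<close> elsewhere.\<close>

lemma (in prob_space) ergodic_sums_nonpositive:
  fixes f :: "'a \<Rightarrow> real"
  assumes T: "T \<in> measurable M M" "distr M M T = M"
    and f: "integrable M f" "expectation f < 0"
  shows "\<not> (AE x in M. \<exists>n. 0 < (\<Sum>k<n. f ((T ^^ k) x)))"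
proof
  assume pos: "AE x in M. \<exists>n. 0 < (\<Sum>k<n. f ((T ^^ k) x))"
  \<comment> \<open>The recursion produces the maximum because adding \<open>f x\<close> to an
    ergodic sum started at \<open>T x\<close> gives the next longer sum started at
    \<open>x\<close>.\<close>
  define N :: "nat \<Rightarrow> 'a \<Rightarrow> real" where
    "N = rec_nat (\<lambda>x. 0) (\<lambda>k N x. max 0 (f x + N (T x)))"
  have N_simps: "N 0 x = 0" "N (Suc k) x = max 0 (f x + N k (T x))" for k x
    by (simp_all add: N_def)
  have int_T: "integrable M (\<lambda>x. g (T x))" "expectation (\<lambda>x. g (T x)) = expectation g"
    if "integrable M g" for g :: "'a \<Rightarrow> real"
  proof -
    have "g \<in> borel_measurable M" using that by simp
    then show "integrable M (\<lambda>x. g (T x))" "expectation (\<lambda>x. g (T x)) = expectation g"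
      using that T integrable_distr_eq[OF T(1), of g] integral_distr[OF T(1), of g] by simp_all
  qed
  have int_N: "integrable M (N k)" for k
  proof (induction k)
    case (Suc k)
    then show ?case using f int_T unfolding N_simps by simp
  qed (simp add: N_simps)
  have N_nonneg: "0 \<le> N k x" for k x by (cases k) (simp_all add: N_simps)
  have N_Suc: "N k x \<le> N (Suc k) x" for k x
  proof (induction k arbitrary: x)
    case (Suc k)
    then show ?case unfolding N_simps(2)[of "Suc k"] N_simps(2)[of k]
      by (intro max.mono add_left_mono) auto
  qed (simp add: N_simps)
  have N_mono: "N j x \<le> N k x" if "j \<le> k" for j k x
    using that N_Suc by (rule lift_Suc_mono_le[of "\<lambda>k. N k x", rotated])
  have sum_le: "(\<Sum>k<n. f ((T ^^ k) x)) \<le> N n x" for n x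
  proof (induction n arbitrary: x)
    case (Suc n)
    have "(\<Sum>k<Suc n. f ((T ^^ k) x)) = f x + (\<Sum>k<n. f ((T ^^ k) (T x)))"
      by (simp only: sum.lessThan_Suc_shift funpow_Suc_right o_apply funpow_0)
    also have "\<dots> \<le> f x + N n (T x)" using Suc by simp
    finally show ?case by (simp add: N_simps)
  qed (simp add: N_simps)
  define g where "g k x = f x * indicator {x. 0 < N (Suc k) x} x" for k x
  have g_meas: "g k \<in> borel_measurable M" for k
    using int_N[of "Suc k"] f(1) unfolding g_def indicator_def by measurable
  have int_g: "integrable M (g k)" for k
    using f(1) g_meas
    by (rule Bochner_Integration.integrable_bound) (auto simp: g_def indicator_def)
  have "0 \<le> expectation (g k)" for k
  proof -
    have "0 \<le> expectation (N (Suc k)) - expectation (N k)"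
      using int_N N_Suc by (simp add: integral_mono)
    also have "\<dots> = expectation (\<lambda>x. N (Suc k) x - N k (T x))"
      using int_N int_T by simp
    also have "\<dots> \<le> expectation (g k)"
    proof (rule integral_mono)
      show "integrable M (\<lambda>x. N (Suc k) x - N k (T x))" using int_N int_T by simp
      show "N (Suc k) x - N k (T x) \<le> g k x" for x
        using N_nonneg[of k "T x"] by (simp add: g_def N_simps(2) indicator_def)
    qed (rule int_g)
    finally show ?thesis .
  qed
  \<comment> \<open>Under the assumption to be refuted, almost every point eventually lies in
    \<open>{x. 0 < N (Suc k) x}\<close>, so \<open>g k\<close> converges to
    \<open>f\<close>.\<close>
  moreover have "(\<lambda>k. expectation (g k)) \<longlonglongrightarrow> expectation f"
  proof (rule integral_dominated_convergence[where w = "\<lambda>x. \<bar>f x\<bar>"])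
    show "AE x in M. (\<lambda>k. g k x) \<longlonglongrightarrow> f x"
      using pos
    proof eventually_elim
      case (elim x)
      then obtain n where "0 < (\<Sum>k<n. f ((T ^^ k) x))" by blast
      then have "0 < N (Suc k) x" if "k \<ge> n" for k
        using sum_le[of x n] N_mono[of n "Suc k" x] that by simp
      then have "\<forall>\<^sub>F k in sequentially. g k x = f x"
        unfolding eventually_sequentially by (auto simp: g_def indicator_def intro!: exI[of _ n])
      then show ?case by (rule tendsto_eventually)
    qed
  qed (use f g_meas in \<open>auto simp: g_def indicator_def\<close>)
  ultimately have "0 \<le> expectation f" by (intro LIMSEQ_le_const) auto
  with f(2) show False by simp
qed

section \<open>Ergodic environments\<close>

lemma image_add_bonds:
  assumes "b \<in> bonds"
  shows "(+) z ` b \<in> bonds"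
proof -
  obtain u v where "b = {u, v}" "nearest_neighbor u v" using assms by (auto simp: bonds_def)
  then have "(+) z ` b = {z + u, z + v}" "nearest_neighbor (z + u) (z + v)" by simp_all
  then show ?thesis unfolding bonds_def by blast
qed

lemma bonds_cases:
  assumes "b \<in> bonds"
  obtains z e where "nearest_neighbor 0 e" "b = (+) z ` {0, e}"
proof -
  obtain u v where "b = {u, v}" "nearest_neighbor u v" using assms by (auto simp: bonds_def)
  then show thesis by (intro that[of "v - u" u]) (simp_all add: nearest_neighbor_diff[of u])
qed

lemma bond_at_0: "nearest_neighbor 0 e \<Longrightarrow> {0, e} \<in> bonds"
  by (auto simp: bonds_def)

lemma space_config_space: "space config_space = extensional bonds"
  by (simp add: config_space_def space_PiM PiE_def)

lemma translate_in_space: "translate z \<xi> \<in> space config_space"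
  by (simp add: space_config_space translate_def)

lemma measurable_coordinate: "b \<in> bonds \<Longrightarrow> (\<lambda>\<xi>. \<xi> b) \<in> borel_measurable config_space"
  unfolding config_space_def by (rule measurable_component_singleton)

lemma measurable_translate: "translate z \<in> measurable config_space config_space"
  unfolding translate_def config_space_def
  using measurable_coordinate[unfolded config_space_def] image_add_bonds
  by (intro measurable_restrict) auto

lemma measurable_path_sum:
  assumes "\<omega> \<in> saws x" "g \<in> borel_measurable borel"
  shows "(\<lambda>\<xi>. path_sum (\<lambda>b. g (\<xi> b)) \<omega>) \<in> borel_measurable config_space"
  unfolding path_sum_def
proof (rule borel_measurable_sum)
  fix j assume "j \<in> {1..path_length \<omega>}"
  then have "path_bond \<omega> j \<in> bonds"
    using assms(1) by (auto simp: saws_def path_bond_in_bonds)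
  from measurable_compose[OF measurable_coordinate[OF this] assms(2)]
  show "(\<lambda>\<xi>. g (\<xi> (path_bond \<omega> j))) \<in> borel_measurable config_space" .
qed

lemma measurable_path_weight:
  assumes "\<omega> \<in> saws x"
  shows "(\<lambda>\<xi>. path_weight (\<lambda>b. h + \<beta> * \<xi> b) \<omega>) \<in> borel_measurable config_space"
proof -
  have [measurable]: "(\<lambda>\<xi>. path_sum (\<lambda>b. h + \<beta> * \<xi> b) \<omega>) \<in> borel_measurable config_space"
    using assms by (rule measurable_path_sum) measurable
  show ?thesis unfolding path_weight_def by measurable
qed

lemma measurable_quenched_susceptibility:
  "(\<lambda>\<xi>. quenched_susceptibility h \<beta> \<xi> (x :: int ^ 'd::finite)) \<in> borel_measurable config_space"
  unfolding quenched_susceptibility_eq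
  by (intro borel_measurable_infsum_ennreal countable_saws measurable_path_weight)

text \<open>Every \<open>h\<close> in an upward closed set is a limit of rationals from above that
  also belong to it. The critical point is thus determined by countably many almost sure
  statements.\<close>

lemma Inf_ereal_eq_Inf_rational:
  assumes "\<And>h h'. h \<in> U \<Longrightarrow> h \<le> h' \<Longrightarrow> h' \<in> U"
  shows "Inf (ereal ` U) = Inf (ereal ` (U \<inter> \<rat>))"
proof (rule antisym)
  show "Inf (ereal ` (U \<inter> \<rat>)) \<le> Inf (ereal ` U)"
  proof (rule Inf_greatest, clarify)
    fix h assume h: "h \<in> U"
    show "Inf (ereal ` (U \<inter> \<rat>)) \<le> ereal h"
    proof (rule ereal_le_epsilon2)
      fix e :: real assume "0 < e"
      then obtain q where "q \<in> \<rat>" "h < q" "q < h + e" using Rats_dense_in_real[of h "h + e"] by auto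
      then have "Inf (ereal ` (U \<inter> \<rat>)) \<le> ereal q"
        using h assms by (intro Inf_lower) auto
      also have "ereal q \<le> ereal h + ereal e" using \<open>q < h + e\<close> by simp
      finally show "Inf (ereal ` (U \<inter> \<rat>)) \<le> ereal h + ereal e" .
    qed
  qed
qed (auto intro: Inf_superset_mono)

text \<open>The canonical setting, where the sample point is the environment itself and translations
  act on it. A general pair of \<open>M\<close> and \<open>X\<close> is reduced to it by passing to
  the law of the field.\<close>

locale ergodic_environment = prob_space P
  for P :: "((int ^ 'd::finite) set \<Rightarrow> real) measure" +
  fixes \<beta> m :: real
  assumes sets_P: "sets P = sets config_space"
    and integrable_coordinate: "\<And>b. b \<in> bonds \<Longrightarrow> integrable P (\<lambda>\<xi>. \<xi> b)"
    and expectation_coordinate: "\<And>b. b \<in> bonds \<Longrightarrow> expectation (\<lambda>\<xi>. \<xi> b) = m"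
    and invariant: "translation_invariant P"
    and ergodic: "translation_ergodic P"
    and \<beta>_nonneg: "0 \<le> \<beta>"
begin

section \<open>The zero-one law and the constancy of the critical point\<close>

lemma space_P: "space P = space config_space"
  using sets_P by (rule sets_eq_imp_space_eq)

lemma measurable_P: "measurable P = measurable config_space"
  using measurable_cong_sets[OF sets_P refl] by blast

lemma measurable_P_P: "measurable P P = measurable config_space config_space"
  by (rule measurable_cong_sets[OF sets_P sets_P])

lemma distr_translate: "distr P P (translate z) = P"
  using invariant distr_cong[OF refl sets_P] unfolding translation_invariant_def by metis

text \<open>A deterministic property of \<open>h\<close>. The origin stands for all starting points
  by \<open>quenched_susceptibility_finite_iff\<close>.\<close>

definition finite_susceptibility :: "real \<Rightarrow> bool" where
  "finite_susceptibility h \<longleftrightarrow> (AE \<xi> in P. quenched_susceptibility h \<beta> \<xi> 0 < \<infinity>)"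

text \<open>Invariance is required at every point of the space, since
  \<open>translation_ergodic\<close> speaks of sets that equal their preimages exactly.\<close>

lemma zero_one_law:
  assumes "Measurable.pred P Q"
    and "\<And>z \<xi>. \<xi> \<in> space P \<Longrightarrow> Q (translate z \<xi>) \<longleftrightarrow> Q \<xi>"
  shows "(AE \<xi> in P. Q \<xi>) \<or> (AE \<xi> in P. \<not> Q \<xi>)"
proof -
  let ?A = "{\<xi>\<in>space P. Q \<xi>}"
  have A: "?A \<in> sets P" using assms(1) by measurable
  moreover have "translate z -` ?A \<inter> space P = ?A" for z
    using assms(2) translate_in_space by (auto simp: space_P)
  ultimately have "prob ?A = 0 \<or> prob ?A = 1"
    using ergodic unfolding translation_ergodic_def by blast
  then show ?thesis
    using prob_Collect_eq_0[OF A] prob_Collect_eq_1[OF A] by blast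
qed

lemma finite_susceptibility_cases:
  "finite_susceptibility h \<or> (AE \<xi> in P. \<not> quenched_susceptibility h \<beta> \<xi> 0 < \<infinity>)"
  unfolding finite_susceptibility_def
proof (rule zero_one_law)
  have [measurable]: "(\<lambda>\<xi>. quenched_susceptibility h \<beta> \<xi> 0) \<in> borel_measurable P"
    unfolding measurable_P by (rule measurable_quenched_susceptibility)
  show "Measurable.pred P (\<lambda>\<xi>. quenched_susceptibility h \<beta> \<xi> 0 < \<infinity>)" by measurable
  show "quenched_susceptibility h \<beta> (translate z \<xi>) 0 < \<infinity> \<longleftrightarrow>
    quenched_susceptibility h \<beta> \<xi> 0 < \<infinity>" for z \<xi>
    unfolding quenched_susceptibility_translate by (rule quenched_susceptibility_finite_iff)
qed

lemma finite_susceptibility_mono: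
  assumes "finite_susceptibility h" "h \<le> h'"
  shows "finite_susceptibility h'"
  using assms(1) unfolding finite_susceptibility_def
  by eventually_elim (rule le_less_trans[OF quenched_susceptibility_antimono[OF assms(2)]])

text \<open>Outside one null set, finiteness at every rational \<open>h\<close> agrees with the
  deterministic property. Both sets of parameters are upward closed, so equal rational parts give
  equal infima.\<close>

lemma AE_quenched_critical_point:
  "AE \<xi> in P. \<forall>x. quenched_critical_point \<beta> \<xi> x = Inf (ereal ` {h. finite_susceptibility h})"
proof -
  have "AE \<xi> in P. \<forall>h\<in>\<rat>. quenched_susceptibility h \<beta> \<xi> 0 < \<infinity> \<longleftrightarrow> finite_susceptibility h"
  proof (subst AE_ball_countable[OF countable_rat], rule ballI)
    fix h :: real
    show "AE \<xi> in P. quenched_susceptibility h \<beta> \<xi> 0 < \<infinity> \<longleftrightarrow> finite_susceptibility h"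
    proof (cases "finite_susceptibility h")
      case True
      then show ?thesis by (simp add: finite_susceptibility_def)
    next
      case False
      then show ?thesis using finite_susceptibility_cases[of h] by auto
    qed
  qed
  then show ?thesis
  proof eventually_elim
    case (elim \<xi>)
    show ?case
    proof
      fix x
      let ?U = "{h. quenched_susceptibility h \<beta> \<xi> 0 < \<infinity>}"
      have "quenched_critical_point \<beta> \<xi> x = Inf (ereal ` ?U)"
        unfolding quenched_critical_point_def
        using quenched_susceptibility_finite_iff[of _ \<beta> \<xi> x 0] by auto
      also have "\<dots> = Inf (ereal ` (?U \<inter> \<rat>))"
        by (rule Inf_ereal_eq_Inf_rational)
          (auto intro: le_less_trans[OF quenched_susceptibility_antimono])
      also have "?U \<inter> \<rat> = {h. finite_susceptibility h} \<inter> \<rat>"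
        using elim by auto
      also have "Inf (ereal ` \<dots>) = Inf (ereal ` {h. finite_susceptibility h})"
        by (rule Inf_ereal_eq_Inf_rational [symmetric]) (auto intro: finite_susceptibility_mono)
      finally show "quenched_critical_point \<beta> \<xi> x = Inf (ereal ` {h. finite_susceptibility h})" .
    qed
  qed
qed

section \<open>The annealed upper bound and the tools for the lower bound\<close>

lemma finite_susceptibility_if_annealed:
  assumes "(\<integral>\<^sup>+ \<xi>. quenched_susceptibility h \<beta> \<xi> x \<partial>P) < \<infinity>"
  shows "finite_susceptibility h"
proof -
  have "AE \<xi> in P. quenched_susceptibility h \<beta> \<xi> x \<noteq> \<infinity>"
    using assms measurable_quenched_susceptibility
    by (intro nn_integral_PInf_AE) (auto simp: measurable_P)
  then show ?thesis
    unfolding finite_susceptibility_def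
    by eventually_elim
      (metis infinity_ennreal_def quenched_susceptibility_finite_iff top.not_eq_extremum)
qed

text \<open>By translation invariance only the finitely many bonds at the origin matter.\<close>

lemma truncated_mean:
  assumes "0 < \<delta>"
  shows "\<exists>K. \<forall>b\<in>bonds. expectation (\<lambda>\<xi>. max (\<xi> b) (- K)) \<le> m + \<delta>"
proof -
  have "\<forall>\<^sub>F n in sequentially. expectation (\<lambda>\<xi>. max (\<xi> {0, e}) (- real n)) < m + \<delta>"
    if "nearest_neighbor 0 e" for e :: "int ^ 'd"
  proof -
    note b = bond_at_0[OF that]
    have "(\<lambda>n. expectation (\<lambda>\<xi>. max (\<xi> {0, e}) (- real n))) \<longlonglongrightarrow> expectation (\<lambda>\<xi>. \<xi> {0, e})"
    proof (rule integral_dominated_convergence[where w = "\<lambda>\<xi>. \<bar>\<xi> {0, e}\<bar>"])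
      show "AE \<xi> in P. (\<lambda>n. max (\<xi> {0, e}) (- real n)) \<longlonglongrightarrow> \<xi> {0, e}"
      proof (intro AE_I2 tendsto_eventually)
        fix \<xi> :: "(int ^ 'd) set \<Rightarrow> real"
        obtain n where "- \<xi> {0, e} \<le> real n" using real_arch_simple by blast
        then show "\<forall>\<^sub>F n in sequentially. max (\<xi> {0, e}) (- real n) = \<xi> {0, e}"
          unfolding eventually_sequentially by (intro exI[of _ n]) auto
      qed
    qed (use integrable_coordinate[OF b] in auto)
    then show ?thesis
      using expectation_coordinate[OF b] assms by (intro order_tendstoD) auto
  qed
  then have "\<forall>\<^sub>F n in sequentially. \<forall>e\<in>{e. nearest_neighbor 0 e}.
      expectation (\<lambda>\<xi>. max (\<xi> {0, e}) (- real n)) < m + \<delta>"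
    by (intro eventually_ball_finite finite_neighbors) auto
  then obtain n where n: "\<And>e. nearest_neighbor 0 e \<Longrightarrow>
      expectation (\<lambda>\<xi>. max (\<xi> {0, e}) (- real n)) < m + \<delta>"
    by (auto simp: eventually_sequentially)
  have "expectation (\<lambda>\<xi>. max (\<xi> b) (- real n)) \<le> m + \<delta>" if "b \<in> bonds" for b
  proof -
    from \<open>b \<in> bonds\<close> obtain z e where e: "nearest_neighbor 0 e" and b: "b = (+) z ` {0, e}"
      by (rule bonds_cases)
    let ?g = "\<lambda>\<xi>. max (\<xi> {0, e}) (- real n)"
    have [measurable]: "(\<lambda>\<xi>. \<xi> {0, e}) \<in> borel_measurable P"
      using integrable_coordinate[OF bond_at_0[OF e]] by simp
    have "expectation ?g = integral\<^sup>L (distr P P (translate z)) ?g"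
      by (simp add: distr_translate)
    also have "\<dots> = expectation (\<lambda>\<xi>. ?g (translate z \<xi>))"
      using measurable_translate by (intro integral_distr) (simp_all add: measurable_P_P)
    also have "\<dots> = expectation (\<lambda>\<xi>. max (\<xi> b) (- real n))"
      using bond_at_0[OF e] by (simp add: translate_def b)
    finally show ?thesis using n[OF e] by simp
  qed
  then show ?thesis by blast
qed

end

text \<open>Jensen's inequality for the uniform distribution on \<open>S\<close>: \<open>exp\<close>
  lies above its tangent at the mean \<open>a\<close>, and the linear terms sum to zero.\<close>

lemma card_mult_exp_mean_le_sum_exp:
  fixes t :: "'a \<Rightarrow> real"
  assumes "finite S"
  shows "card S * exp (sum t S / card S) \<le> (\<Sum>x\<in>S. exp (t x))"
proof (cases "S = {}")
  case False
  define a where "a = sum t S / card S"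
  have card: "card S > 0" using assms False by (simp add: card_gt_0_iff)
  have "(\<Sum>x\<in>S. exp a * (1 + (t x - a))) \<le> (\<Sum>x\<in>S. exp a * exp (t x - a))"
    by (intro sum_mono mult_left_mono exp_ge_add_one_self) auto
  also have "\<dots> = (\<Sum>x\<in>S. exp (t x))" by (simp add: mult_exp_exp)
  also have "(\<Sum>x\<in>S. exp a * (1 + (t x - a))) = exp a * (card S + sum t S - card S * a)"
    by (simp add: sum_distrib_left [symmetric] sum.distrib sum_subtractf)
  also have "\<dots> = card S * exp a" using card by (simp add: a_def)
  finally show ?thesis by (simp add: a_def)
qed simp

context ergodic_environment
begin

text \<open>Jensen's inequality bounds the weight of the paths of length \<open>n\<close> from below by their number
  and their mean energy, and Fatou's lemma, applied to the mean energy of the environment truncated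
  from below, makes the latter at most \<open>n (m + 2 \<delta>)\<close> for infinitely many \<open>n\<close>.\<close>

lemma lower_bound:
  assumes "finite_susceptibility h"
  shows "h0 TYPE('d) - \<beta> * m \<le> h"
proof (rule ccontr)
  define \<eta> where "\<eta> = h0 TYPE('d) - \<beta> * m - h"
  assume "\<not> ?thesis"
  then have \<eta>: "0 < \<eta>" by (simp add: \<eta>_def)
  \<comment> \<open>One \<open>\<delta>\<close> pays for the truncation and the other leaves the gap
    that contradicts Fatou's lemma. The summand 1 keeps the denominator positive when
    \<open>\<beta> = 0\<close>.\<close>
  define \<delta> where "\<delta> = \<eta> / (2 * (\<beta> + 1))"
  have \<delta>: "0 < \<delta>" using \<eta> \<beta>_nonneg by (simp add: \<delta>_def)
  have \<eta>_ge: "2 * \<beta> * \<delta> \<le> \<eta>"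
    using \<eta> \<beta>_nonneg by (simp add: \<delta>_def field_simps)
  obtain K where K: "\<And>b. b \<in> bonds \<Longrightarrow> expectation (\<lambda>\<xi>. max (\<xi> b) (- K)) \<le> m + \<delta>"
    using truncated_mean[OF \<delta>] by blast
  define S where "S n = saws_of_length n (0 :: int ^ 'd)" for n
  define c where "c n = real (card (S n))" for n
  have finite_S: "finite (S n)" for n unfolding S_def by (rule finite_saws_of_length)
  have c_ge: "1 \<le> c n" "exp (n * h0 TYPE('d)) \<le> c n" for n
    using saw_count_pos[where ?'d = 'd, of n] exp_h0_le_saw_count[where ?'d = 'd, of n]
    by (simp_all add: c_def S_def card_saws_of_length)
  have S_saws: "\<omega> \<in> saws 0" "path_length \<omega> = n" if "\<omega> \<in> S n" for \<omega> n
    using that by (simp_all add: S_def saws_of_length_def)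
  have disjoint_S: "S i \<inter> S j = {}" if "i \<noteq> j" for i j
    using that S_saws(2) by blast
  define Y where "Y \<xi> b = max (\<xi> b) (- K)" for \<xi> :: "(int ^ 'd) set \<Rightarrow> real" and b
  \<comment> \<open>The energy per bond of the truncated field, averaged over all paths of length
    \<open>n\<close>; at \<open>n = 0\<close> the quotient is 0 by convention, hence the restriction
    to \<open>n \<ge> 1\<close> below.\<close>
  define B where "B n \<xi> = (\<Sum>\<omega>\<in>S n. path_sum (Y \<xi>) \<omega>) / (n * c n)" for n \<xi>
  have int_Y: "integrable P (\<lambda>\<xi>. Y \<xi> b)" if "b \<in> bonds" for b
    using integrable_coordinate[OF that] unfolding Y_def by simp
  have path_bond: "path_bond \<omega> j \<in> bonds" if "\<omega> \<in> S n" "j \<in> {1..path_length \<omega>}" for \<omega> j n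
    using S_saws(1)[OF that(1)] that(2) by (auto simp: saws_def path_bond_in_bonds)
  have int_sum: "integrable P (\<lambda>\<xi>. path_sum (Y \<xi>) \<omega>)" if "\<omega> \<in> S n" for \<omega> n
    unfolding path_sum_def using that by (intro Bochner_Integration.integrable_sum int_Y path_bond)
  have int_B: "integrable P (B n)" for n
    unfolding B_def using int_sum by auto
  have B_ge: "- K \<le> B n \<xi>" if "n \<ge> 1" for n \<xi>
  proof -
    have "(\<Sum>\<omega>\<in>S n. - K * real n) \<le> (\<Sum>\<omega>\<in>S n. path_sum (Y \<xi>) \<omega>)"
    proof (rule sum_mono)
      fix \<omega> assume w: "\<omega> \<in> S n"
      have "path_sum (\<lambda>b. - K) \<omega> \<le> path_sum (Y \<xi>) \<omega>"
        using S_saws(1)[OF w] by (rule path_sum_mono) (simp add: Y_def)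
      then show "- K * real n \<le> path_sum (Y \<xi>) \<omega>"
        using S_saws(2)[OF w] by (simp add: path_sum_const)
    qed
    then have "- K * (n * c n) \<le> (\<Sum>\<omega>\<in>S n. path_sum (Y \<xi>) \<omega>)"
      by (simp add: c_def algebra_simps)
    then show ?thesis
      using that c_ge(1)[of n] unfolding B_def by (subst pos_le_divide_eq) auto
  qed
  have E_B: "expectation (B n) \<le> m + \<delta>" if "n \<ge> 1" for n
  proof -
    have "expectation (\<lambda>\<xi>. path_sum (Y \<xi>) \<omega>) \<le> n * (m + \<delta>)" if w: "\<omega> \<in> S n" for \<omega>
    proof -
      have "expectation (\<lambda>\<xi>. path_sum (Y \<xi>) \<omega>) =
          (\<Sum>j = 1..path_length \<omega>. expectation (\<lambda>\<xi>. Y \<xi> (path_bond \<omega> j)))"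
        unfolding path_sum_def
        using w by (intro Bochner_Integration.integral_sum int_Y path_bond)
      also have "\<dots> \<le> (\<Sum>j = 1..path_length \<omega>. m + \<delta>)"
        unfolding Y_def using w by (intro sum_mono K path_bond)
      finally show ?thesis using S_saws(2)[OF w] by simp
    qed
    then have "(\<Sum>\<omega>\<in>S n. expectation (\<lambda>\<xi>. path_sum (Y \<xi>) \<omega>)) \<le> (\<Sum>\<omega>\<in>S n. n * (m + \<delta>))"
      by (rule sum_mono)
    also have "\<dots> = (m + \<delta>) * (n * c n)" by (simp add: c_def)
    finally have "(\<Sum>\<omega>\<in>S n. expectation (\<lambda>\<xi>. path_sum (Y \<xi>) \<omega>)) \<le> (m + \<delta>) * (n * c n)" .
    moreover have "expectation (B n) = (\<Sum>\<omega>\<in>S n. expectation (\<lambda>\<xi>. path_sum (Y \<xi>) \<omega>)) / (n * c n)"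
      unfolding B_def using int_sum by (simp add: Bochner_Integration.integral_sum)
    ultimately show ?thesis
      using that c_ge(1)[of n] by (simp add: pos_divide_le_eq)
  qed
  have weight_ge: "1 \<le> sum (path_weight (\<lambda>b. h + \<beta> * \<xi> b)) (S n)"
    if "n \<ge> 1" and B: "B n \<xi> \<le> m + 2 * \<delta>" for n \<xi>
  proof -
    have "0 \<le> real n * (\<eta> - 2 * \<beta> * \<delta>)" using \<eta>_ge by simp
    also have "\<dots> = n * h0 TYPE('d) + - (n * (h + \<beta> * (m + 2 * \<delta>)))"
      by (simp add: \<eta>_def algebra_simps)
    also have "\<dots> \<le> n * h0 TYPE('d) + - (n * (h + \<beta> * B n \<xi>))"
      using B \<beta>_nonneg by (simp add: mult_left_mono)
    finally have "1 \<le> exp (n * h0 TYPE('d)) * exp (- (n * (h + \<beta> * B n \<xi>)))"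
      by (simp add: mult_exp_exp)
    also have "\<dots> \<le> c n * exp (- (n * (h + \<beta> * B n \<xi>)))"
      using c_ge(2) by (rule mult_right_mono) simp
    also have "- (n * (h + \<beta> * B n \<xi>)) = (\<Sum>\<omega>\<in>S n. - (h * n + \<beta> * path_sum (Y \<xi>) \<omega>)) / card (S n)"
    proof -
      have "n * B n \<xi> = (\<Sum>\<omega>\<in>S n. path_sum (Y \<xi>) \<omega>) / c n"
        using \<open>n \<ge> 1\<close> by (simp add: B_def)
      then have mean: "- (n * (h + \<beta> * B n \<xi>)) = - (h * n + \<beta> * ((\<Sum>\<omega>\<in>S n. path_sum (Y \<xi>) \<omega>) / c n))"
        by (simp add: algebra_simps)
      have total: "(\<Sum>\<omega>\<in>S n. - (h * n + \<beta> * path_sum (Y \<xi>) \<omega>)) =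
          - (c n * (h * n) + \<beta> * (\<Sum>\<omega>\<in>S n. path_sum (Y \<xi>) \<omega>))"
        unfolding sum_negf sum.distrib sum_distrib_left by (simp add: c_def)
      show ?thesis
        unfolding mean total using c_ge(1)[of n] by (simp add: c_def [symmetric] field_simps)
    qed
    also have "c n * exp \<dots> \<le> (\<Sum>\<omega>\<in>S n. exp (- (h * n + \<beta> * path_sum (Y \<xi>) \<omega>)))"
      unfolding c_def using finite_S by (rule card_mult_exp_mean_le_sum_exp)
    \<comment> \<open>Removing the truncation lowers the energy because \<open>\<beta>\<close> is
      nonnegative, so the true weights are at least as large.\<close>
    also have "\<dots> \<le> (\<Sum>\<omega>\<in>S n. exp (- path_sum (\<lambda>b. h + \<beta> * \<xi> b) \<omega>))"
    proof (rule sum_mono)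
      fix \<omega> assume w: "\<omega> \<in> S n"
      have "path_sum \<xi> \<omega> \<le> path_sum (Y \<xi>) \<omega>"
        using S_saws(1)[OF w] by (rule path_sum_mono) (simp add: Y_def)
      then show "exp (- (h * n + \<beta> * path_sum (Y \<xi>) \<omega>)) \<le> exp (- path_sum (\<lambda>b. h + \<beta> * \<xi> b) \<omega>)"
        using S_saws(2)[OF w] \<beta>_nonneg by (simp add: path_sum_affine mult_left_mono)
    qed
    finally have "ennreal 1 \<le> ennreal (\<Sum>\<omega>\<in>S n. exp (- path_sum (\<lambda>b. h + \<beta> * \<xi> b) \<omega>))"
      by (rule ennreal_leI)
    then show ?thesis by (simp add: path_weight_def sum_ennreal)
  qed
  \<comment> \<open>Otherwise infinitely many lengths would each contribute at least 1 and the
    susceptibility would be infinite.\<close>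
  have large: "AE \<xi> in P. \<forall>\<^sub>F n in sequentially. m + 2 * \<delta> < B n \<xi>"
    using assms unfolding finite_susceptibility_def
  proof eventually_elim
    case (elim \<xi>)
    show ?case
    proof (rule ccontr)
      assume "\<not> ?thesis"
      then have "\<exists>\<^sub>F n in sequentially. B n \<xi> \<le> m + 2 * \<delta>"
        by (simp add: not_eventually not_less)
      then have "\<exists>\<^sub>F n in sequentially. 1 \<le> sum (path_weight (\<lambda>b. h + \<beta> * \<xi> b)) (S n)"
        using eventually_ge_at_top[of 1]
        by (rule frequently_rev_mp[OF frequently_eventually_conj])
          (auto intro!: always_eventually weight_ge)
      then have "infsum (path_weight (\<lambda>b. h + \<beta> * \<xi> b)) (saws 0) = \<infinity>"
        using finite_S S_saws(1) disjoint_S by (intro infsum_ennreal_eq_top[of S]) auto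
      then show False using elim by (simp add: quenched_susceptibility_eq)
    qed
  qed
  have "ennreal (m + 2 * \<delta> + K) = (\<integral>\<^sup>+ \<xi>. ennreal (m + 2 * \<delta> + K) \<partial>P)"
    by (simp add: emeasure_space_1)
  also have "\<dots> \<le> (\<integral>\<^sup>+ \<xi>. liminf (\<lambda>n. ennreal (B n \<xi> + K)) \<partial>P)"
  proof (rule nn_integral_mono_AE)
    show "AE \<xi> in P. ennreal (m + 2 * \<delta> + K) \<le> liminf (\<lambda>n. ennreal (B n \<xi> + K))"
      using large
    proof eventually_elim
      case (elim \<xi>)
      then have "\<forall>\<^sub>F n in sequentially. ennreal (m + 2 * \<delta> + K) \<le> ennreal (B n \<xi> + K)"
        by eventually_elim (auto intro: ennreal_leI)
      then show ?case by (rule Liminf_bounded)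
    qed
  qed
  also have "\<dots> \<le> liminf (\<lambda>n. \<integral>\<^sup>+ \<xi>. ennreal (B n \<xi> + K) \<partial>P)"
    using int_B by (intro nn_integral_liminf) auto
  also have "\<dots> \<le> liminf (\<lambda>n. ennreal (m + \<delta> + K))"
  proof (rule Liminf_mono)
    show "\<forall>\<^sub>F n in sequentially. (\<integral>\<^sup>+ \<xi>. ennreal (B n \<xi> + K) \<partial>P) \<le> ennreal (m + \<delta> + K)"
      using eventually_ge_at_top[of 1]
    proof eventually_elim
      case (elim n)
      have "0 \<le> B n \<xi> + K" for \<xi> using B_ge[OF elim, of \<xi>] by simp
      then have "(\<integral>\<^sup>+ \<xi>. ennreal (B n \<xi> + K) \<partial>P) = ennreal (expectation (\<lambda>\<xi>. B n \<xi> + K))"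
        using int_B \<open>\<And>\<xi>. 0 \<le> B n \<xi> + K\<close> by (intro nn_integral_eq_integral) auto
      also have "expectation (\<lambda>\<xi>. B n \<xi> + K) = expectation (B n) + K"
        using int_B by (simp add: prob_space)
      finally show ?case using E_B[OF elim] by (simp add: ennreal_leI)
    qed
  qed
  finally have "ennreal (m + 2 * \<delta> + K) \<le> ennreal (m + \<delta> + K)"
    by (simp add: Liminf_const)
  \<comment> \<open>Needed because \<open>ennreal\<close> sends negative numbers to 0; with it the
    inequality just derived is a genuine one between reals.\<close>
  moreover have "0 \<le> m + \<delta> + K"
  proof -
    have "expectation (\<lambda>\<xi>. - K) \<le> expectation (B 1)"
      using int_B B_ge by (intro integral_mono) auto
    then show ?thesis using E_B[of 1] by (simp add: prob_space)
  qed
  ultimately show False using \<delta> by simp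
qed

end

section \<open>Rays and the one-dimensional lattice\<close>

lemma inj_ray: "inj (ray x e)"
  by (rule injI) (metis length_ray nat.inject)

text \<open>Bonds are written as translates of \<open>{0, e}\<close>, so that the sum becomes an
  ergodic sum of a single coordinate under \<open>translate e\<close>.\<close>

lemma path_sum_ray: "path_sum f (ray x e n) = (\<Sum>k<n. f ((+) (x + int k *s e) ` {0, e}))"
proof (induction n arbitrary: x)
  case (Suc n)
  have "ray x e (Suc n) = x # (x + e) # tl (ray (x + e) e n)"
    by (metis hd_ray length_ray length_0_conv list.collapse nat.distinct(1) ray_Suc)
  moreover have "ray (x + e) e n = (x + e) # tl (ray (x + e) e n)"
    by (metis hd_ray length_ray length_0_conv list.collapse nat.distinct(1))
  ultimately have "path_sum f (ray x e (Suc n)) = f {x, x + e} + path_sum f (ray (x + e) e n)"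
    by (metis path_sum_Cons)
  also have "\<dots> = f ((+) (x + int 0 *s e) ` {0, e}) + (\<Sum>k<n. f ((+) (x + int (Suc k) *s e) ` {0, e}))"
    by (simp add: Suc vector_sadd_rdistrib add.assoc)
  also have "\<dots> = (\<Sum>k<Suc n. f ((+) (x + int k *s e) ` {0, e}))"
    by (rule sum.lessThan_Suc_shift [symmetric])
  finally show ?case .
qed simp

lemma infsum_path_weight_range_ray_le:
  "infsum (path_weight f) (range (ray x e)) \<le> (\<Sum>n. path_weight f (ray x e n))"
  unfolding infsum_ennreal_eq_SUP
proof (rule SUP_least, clarify)
  fix F assume F: "finite F" "F \<subseteq> range (ray x e)"
  then obtain N where N: "finite N" "F = ray x e ` N" by (meson finite_subset_image)
  have "sum (path_weight f) F = (\<Sum>n\<in>N. path_weight f (ray x e n))"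
    unfolding N(2) using inj_ray by (subst sum.reindex) (auto intro: inj_on_subset)
  also have "\<dots> \<le> (\<Sum>n. path_weight f (ray x e n))"
    using N(1) by (intro sum_le_suminf) auto
  finally show "sum (path_weight f) F \<le> (\<Sum>n. path_weight f (ray x e n))" .
qed

text \<open>The path of length 0 has weight 1, and all others share the first bond. Its weight is
  positive and finite, so the sums at \<open>x\<close> and at \<open>x + e\<close> are finite
  together.\<close>

lemma suminf_path_weight_ray_step:
  "(\<Sum>n. path_weight f (ray x e n)) = 1 + ennreal (exp (- f {x, x + e})) * (\<Sum>n. path_weight f (ray (x + e) e n))"
proof -
  have "path_weight f (ray x e (Suc n)) = ennreal (exp (- f {x, x + e})) * path_weight f (ray (x + e) e n)" for n
  proof -
    have "path_sum f (ray x e (Suc n)) = f {x, x + e} + path_sum f (ray (x + e) e n)"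
      by (simp add: path_sum_ray sum.lessThan_Suc_shift vector_sadd_rdistrib add.assoc del: sum.lessThan_Suc)
    then show ?thesis
      by (simp add: path_weight_def ennreal_mult [symmetric] mult_exp_exp)
  qed
  moreover have "(\<Sum>n. path_weight f (ray x e n)) =
      (\<Sum>n. path_weight f (ray x e (Suc n))) + path_weight f (ray x e 0)"
    using suminf_offset[of "\<lambda>n. path_weight f (ray x e n)" 1] by (simp add: add.commute)
  ultimately show ?thesis by (simp add: path_weight_def add.commute)
qed

lemma neighbors_of_0_one_dim:
  fixes e s :: "int ^ 'd::finite"
  assumes "CARD('d) = 1" "nearest_neighbor 0 e" "nearest_neighbor 0 s"
  shows "s = e \<or> s = - e"
proof -
  obtain k :: 'd where k: "UNIV = {k}" using assms(1) by (rule card_1_singletonE)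
  have "\<bar>e $ k\<bar> = 1" "\<bar>s $ k\<bar> = 1"
    using assms(2,3) by (simp_all add: nearest_neighbor_def k)
  moreover have "v = w \<longleftrightarrow> v $ k = w $ k" for v w :: "int ^ 'd"
    using k by (auto simp: vec_eq_iff)
  ultimately show ?thesis by (auto simp: abs_if split: if_splits)
qed

text \<open>A path that turned around would step back onto its previous vertex, so the first step
  fixes the direction for good.\<close>

lemma saws_of_length_one_dim:
  fixes e :: "int ^ 'd::finite"
  assumes dim: "CARD('d) = 1" and e: "nearest_neighbor 0 e"
  shows "saws_of_length n x \<subseteq> {ray x e n, ray x (- e) n}"
proof (induction n arbitrary: x)
  case 0
  show ?case by (auto simp: saws_of_length_iff length_Suc_conv)
next
  case (Suc n)
  show ?case
  proof
    fix \<omega> assume w: "\<omega> \<in> saws_of_length (Suc n) x"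
    then obtain y \<omega>' where \<omega>: "\<omega> = x # y # \<omega>'"
      by (auto simp: saws_of_length_iff length_Suc_conv)
    define s where "s = y - x"
    have y: "y = x + s" by (simp add: s_def)
    have "nearest_neighbor 0 s" using w by (simp add: \<omega> s_def saws_of_length_iff nearest_neighbor_diff[of x])
    then have s: "s = e \<or> s = - e" using neighbors_of_0_one_dim[OF dim e] by blast
    have tail: "y # \<omega>' \<in> saws_of_length n y" using w by (simp add: \<omega> saws_of_length_iff)
    then have "y # \<omega>' = ray y s n \<or> y # \<omega>' = ray y (- s) n" using Suc[of y] s by auto
    then have "y # \<omega>' = ray y s n"
    proof
      assume reversed: "y # \<omega>' = ray y (- s) n"
      show ?thesis
      proof (cases n)
        case (Suc k)
        then have "\<omega>' = ray x (- s) k" using reversed by (simp add: ray_Suc y)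
        then have "x \<in> set \<omega>'" by (metis hd_ray hd_in_set length_ray list.size(3) nat.distinct(1))
        then show ?thesis using w by (simp add: \<omega> saws_of_length_iff)
      qed (use reversed in simp)
    qed
    then have "\<omega> = ray x s (Suc n)" by (simp add: \<omega> ray_Suc y)
    then show "\<omega> \<in> {ray x e (Suc n), ray x (- e) (Suc n)}" using s by auto
  qed
qed

text \<open>Closes the one-dimensional chain
  \<open>hq \<le> - \<beta> * m \<le> h0 - \<beta> * m \<le> hq\<close>.\<close>

lemma h0_nonneg: "0 \<le> h0 TYPE('d::finite)"
proof -
  have "1 \<le> root n (real (saw_count TYPE('d) n))" if "n \<ge> 1" for n
    using that saw_count_pos[where ?'d = 'd, of n] by simp
  then have "1 \<le> connective_constant TYPE('d)"
    by (intro LIMSEQ_le_const[OF connective_constant_limit(1)] exI[of _ 1] allI impI)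
  then show ?thesis by (simp add: h0_def)
qed

section \<open>Summability along half-lines\<close>

context ergodic_environment
begin

text \<open>The maximal inequality for \<open>m - \<epsilon> - \<xi> {0, e}\<close>, whose mean is
  \<open>- \<epsilon>\<close>: an ergodic sum of it is positive exactly when the path sum drops
  below the line of slope \<open>m - \<epsilon>\<close>.\<close>

lemma ray_sums_not_below_mean:
  assumes e: "nearest_neighbor 0 e" and \<epsilon>: "0 < \<epsilon>"
  shows "\<not> (AE \<xi> in P. \<exists>n. path_sum \<xi> (ray 0 e n) < n * (m - \<epsilon>))"
proof -
  let ?f = "\<lambda>\<xi> :: (int ^ 'd) set \<Rightarrow> real. (m - \<epsilon>) - \<xi> {0, e}"
  note b = bond_at_0[OF e]
  have iter: "(translate e ^^ k) \<xi> b = \<xi> ((+) (int k *s e) ` b)" if "b \<in> bonds" for k \<xi> b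
    using that
  proof (induction k arbitrary: b)
    case (Suc k)
    have "(translate e ^^ Suc k) \<xi> b = (translate e ^^ k) \<xi> ((+) e ` b)"
      using Suc.prems by (simp add: translate_def)
    also have "\<dots> = \<xi> ((+) (int k *s e) ` (+) e ` b)"
      using Suc.prems by (intro Suc.IH image_add_bonds)
    also have "(+) (int k *s e) ` (+) e ` b = (+) (int (Suc k) *s e) ` b"
      by (simp add: image_image vector_sadd_rdistrib algebra_simps)
    finally show ?case .
  qed simp
  have "\<not> (AE \<xi> in P. \<exists>n. 0 < (\<Sum>k<n. ?f ((translate e ^^ k) \<xi>)))"
  proof (rule ergodic_sums_nonpositive)
    show "translate e \<in> measurable P P"
      unfolding measurable_P_P by (rule measurable_translate)
    show "expectation ?f < 0"
      using integrable_coordinate[OF b] expectation_coordinate[OF b] \<epsilon> by (simp add: prob_space)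
  qed (use integrable_coordinate[OF b] distr_translate in auto)
  moreover have "(\<Sum>k<n. ?f ((translate e ^^ k) \<xi>)) = n * (m - \<epsilon>) - path_sum \<xi> (ray 0 e n)" for n \<xi>
    by (simp add: iter[OF b] sum_subtractf path_sum_ray)
  ultimately show ?thesis by simp
qed

lemma AE_ray_finite_one_dim:
  assumes dim: "CARD('d) = 1" and e: "nearest_neighbor 0 e" and h: "- \<beta> * m < h"
  shows "AE \<xi> in P. (\<Sum>n. path_weight (\<lambda>b. h + \<beta> * \<xi> b) (ray 0 e n)) < \<infinity>"
proof -
  define R where "R \<xi> x = (\<Sum>n. path_weight (\<lambda>b. h + \<beta> * \<xi> b) (ray x e n))" for \<xi> x
  have R_step: "R \<xi> (x + e) < \<infinity> \<longleftrightarrow> R \<xi> x < \<infinity>" for \<xi> x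
    unfolding R_def suminf_path_weight_ray_step[of _ x]
    by (auto simp: ennreal_mult_less_top)
  \<comment> \<open>In dimension one every step is \<open>e\<close> or \<open>- e\<close>, so
    finiteness on one ray spreads to all starting points and becomes a translation-invariant
    event.\<close>
  have R_neighbor: "R \<xi> v < \<infinity>" if uv: "nearest_neighbor u v" and u: "R \<xi> u < \<infinity>" for \<xi> u v
  proof -
    have "v - u = e \<or> v - u = - e"
      using neighbors_of_0_one_dim[OF dim e] uv nearest_neighbor_diff by blast
    then have "v = u + e \<or> u = v + e" by (auto simp: algebra_simps)
    then show ?thesis using u R_step by auto
  qed
  have R_iff: "R \<xi> x < \<infinity> \<longleftrightarrow> R \<xi> y < \<infinity>" for \<xi> x y
    using lattice_connected[of "\<lambda>x. R \<xi> x < \<infinity>"] R_neighbor by blast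
  have R_translate: "R (translate z \<xi>) 0 = R \<xi> z" for z \<xi>
  proof -
    have "translate z \<xi> ((+) (0 + int k *s e) ` {0, e}) = \<xi> ((+) z ` (+) (0 + int k *s e) ` {0, e})" for k
      unfolding translate_def using image_add_bonds[OF bond_at_0[OF e]]
      by (simp only: restrict_apply if_True)
    moreover have "(+) z ` (+) (0 + int k *s e) ` {0, e} = (+) (z + int k *s e) ` {0, e}" for k
      by (simp add: add.assoc)
    ultimately show ?thesis
      unfolding R_def path_weight_def path_sum_ray by (simp only:)
  qed
  have "(AE \<xi> in P. R \<xi> 0 < \<infinity>) \<or> (AE \<xi> in P. \<not> R \<xi> 0 < \<infinity>)"
  proof (rule zero_one_law)
    have [measurable]: "(\<lambda>\<xi>. R \<xi> 0) \<in> borel_measurable P"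
      unfolding R_def measurable_P
      using ray_in_saws_of_length[OF e] saws_of_length_subset
      by (intro borel_measurable_suminf_order measurable_path_weight) blast
    show "Measurable.pred P (\<lambda>\<xi>. R \<xi> 0 < \<infinity>)" by measurable
    show "R (translate z \<xi>) 0 < \<infinity> \<longleftrightarrow> R \<xi> 0 < \<infinity>" for z \<xi>
      unfolding R_translate by (rule R_iff)
  qed
  moreover have "\<not> (AE \<xi> in P. \<not> R \<xi> 0 < \<infinity>)"
  proof
    assume inf: "AE \<xi> in P. \<not> R \<xi> 0 < \<infinity>"
    \<comment> \<open>Small enough that the slope \<open>a\<close> of the energy stays positive,
      also when \<open>\<beta> = 0\<close>.\<close>
    define \<epsilon> where "\<epsilon> = (h + \<beta> * m) / (2 * (\<beta> + 1))"
    have \<epsilon>: "0 < \<epsilon>" using h \<beta>_nonneg by (simp add: \<epsilon>_def)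
    define a where "a = h + \<beta> * (m - \<epsilon>)"
    have "\<beta> * \<epsilon> < h + \<beta> * m"
    proof -
      have "2 * (\<beta> + 1) * \<epsilon> = h + \<beta> * m" using \<beta>_nonneg by (simp add: \<epsilon>_def)
      moreover have "0 \<le> \<beta> * \<epsilon>" using \<epsilon> \<beta>_nonneg by simp
      ultimately show ?thesis using \<epsilon> by (simp add: algebra_simps)
    qed
    then have a: "0 < a" by (simp add: a_def algebra_simps)
    \<comment> \<open>If all path sums stayed above the line, the weights would be dominated by the
      geometric sequence \<open>exp (- a) ^ n\<close>; divergence therefore forces a
      crossing.\<close>
    have "AE \<xi> in P. \<exists>n. path_sum \<xi> (ray 0 e n) < n * (m - \<epsilon>)"
      using inf
    proof eventually_elim
      case (elim \<xi>)
      show ?case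
      proof (rule ccontr)
        assume "\<not> ?thesis"
        then have ge: "n * (m - \<epsilon>) \<le> path_sum \<xi> (ray 0 e n)" for n by (simp add: not_less)
        have "path_weight (\<lambda>b. h + \<beta> * \<xi> b) (ray 0 e n) \<le> ennreal (exp (- a) ^ n)" for n
        proof -
          have "\<beta> * (n * (m - \<epsilon>)) \<le> \<beta> * path_sum \<xi> (ray 0 e n)"
            using ge \<beta>_nonneg by (rule mult_left_mono)
          then have "- (h * n + \<beta> * path_sum \<xi> (ray 0 e n)) \<le> n * (- a)"
            by (simp add: a_def algebra_simps)
          then show ?thesis
            unfolding path_weight_def path_sum_affine exp_of_nat_mult [symmetric]
            by (intro ennreal_leI) (simp add: path_length_def)
        qed
        then have "R \<xi> 0 \<le> (\<Sum>n. ennreal (exp (- a) ^ n))"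
          unfolding R_def by (intro suminf_le) auto
        also have "\<dots> < \<infinity>"
          using a by (simp add: ennreal_suminf_neq_top summable_geometric less_top [symmetric])
        finally show False using elim by simp
      qed
    qed
    then show False using ray_sums_not_below_mean[OF e \<epsilon>] by simp
  qed
  ultimately show ?thesis by (simp add: R_def)
qed

lemma finite_susceptibility_one_dim:
  assumes dim: "CARD('d) = 1" and h: "- \<beta> * m < h"
  shows "finite_susceptibility h"
proof -
  obtain e :: "int ^ 'd" where e: "nearest_neighbor 0 e" using nearest_neighbor_axis by blast
  then have e': "nearest_neighbor 0 (- e)" by (simp add: nearest_neighbor_def)
  show ?thesis
    unfolding finite_susceptibility_def
    using AE_ray_finite_one_dim[OF dim e h] AE_ray_finite_one_dim[OF dim e' h]
  proof eventually_elim
    case (elim \<xi>)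
    let ?w = "path_weight (\<lambda>b. h + \<beta> * \<xi> b)"
    have "quenched_susceptibility h \<beta> \<xi> 0 \<le> infsum ?w (range (ray 0 e) \<union> range (ray 0 (- e)))"
      unfolding quenched_susceptibility_eq
      using saws_of_length_one_dim[OF dim e, of _ 0]
      by (intro infsum_ennreal_mono_set) (fastforce simp: saws_eq_Union)
    also have "\<dots> \<le> infsum ?w (range (ray 0 e)) + infsum ?w (range (ray 0 (- e)))"
      by (rule infsum_ennreal_Un_le)
    also have "\<dots> \<le> (\<Sum>n. ?w (ray 0 e n)) + (\<Sum>n. ?w (ray 0 (- e) n))"
      by (intro add_mono infsum_path_weight_range_ray_le)
    also have "\<dots> < \<infinity>" using elim by simp
    finally show ?case .
  qed
qed

lemma critical_point_bounds:
  defines "hq \<equiv> Inf (ereal ` {h. finite_susceptibility h})"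
  shows "ereal (h0 TYPE('d) - \<beta> * m) \<le> hq"
    and "hq \<le> Inf (ereal ` {h. (\<integral>\<^sup>+ \<xi>. quenched_susceptibility h \<beta> \<xi> x \<partial>P) < \<infinity>})"
    and "CARD('d) = 1 \<Longrightarrow> hq = ereal (h0 TYPE('d) - \<beta> * m)"
proof -
  show lower: "ereal (h0 TYPE('d) - \<beta> * m) \<le> hq"
    unfolding hq_def using lower_bound by (intro Inf_greatest) auto
  show "hq \<le> Inf (ereal ` {h. (\<integral>\<^sup>+ \<xi>. quenched_susceptibility h \<beta> \<xi> x \<partial>P) < \<infinity>})"
    unfolding hq_def using finite_susceptibility_if_annealed by (intro Inf_superset_mono) auto
  assume dim: "CARD('d) = 1"
  have "hq \<le> ereal (- \<beta> * m)"
  proof (rule ereal_le_epsilon2)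
    fix e :: real assume "0 < e"
    then have "hq \<le> ereal (- \<beta> * m + e)"
      unfolding hq_def using finite_susceptibility_one_dim[OF dim] by (intro Inf_lower) auto
    then show "hq \<le> ereal (- \<beta> * m) + ereal e" by simp
  qed
  also have "\<dots> \<le> ereal (h0 TYPE('d) - \<beta> * m)" using h0_nonneg by simp
  finally show "hq = ereal (h0 TYPE('d) - \<beta> * m)" using lower by (rule antisym)
qed

end

theorem theorem1p1:
  fixes M :: "'w measure"
    and X :: "(int ^ 'd) set \<Rightarrow> 'w \<Rightarrow> real"
    and \<beta> m :: real
  assumes "prob_space M"
    and "\<beta> \<ge> 0"
    and "\<And>b. b \<in> bonds \<Longrightarrow> integrable M (X b)"
    and "\<And>b. b \<in> bonds \<Longrightarrow> (LINT w|M. X b w) = m"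
    and "translation_invariant (field_law M X)"
    and "translation_ergodic (field_law M X)"
  shows "(\<exists>hq :: ereal. AE w in M. \<forall>x. quenched_critical_point \<beta> (\<lambda>b. X b w) x = hq) \<and>
    (AE w in M. \<forall>x. ereal (h0 TYPE('d) - \<beta> * m) \<le> quenched_critical_point \<beta> (\<lambda>b. X b w) x \<and>
      quenched_critical_point \<beta> (\<lambda>b. X b w) x \<le> annealed_critical_point M \<beta> X x) \<and>
    (CARD('d) = 1 \<longrightarrow>
      (AE w in M. \<forall>x. quenched_critical_point \<beta> (\<lambda>b. X b w) x = ereal (h0 TYPE('d) - \<beta> * m)))"
proof -
  \<comment> \<open>The map from the probability space of \<open>M\<close> to environments; it makes
    the field \<open>undefined\<close> outside \<open>bonds\<close>, which leaves susceptibilities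
    unchanged.\<close>
  define \<Phi> where "\<Phi> = (\<lambda>w. \<lambda>b\<in>bonds. X b w)"
  have \<Phi>: "\<Phi> \<in> measurable M config_space"
    unfolding \<Phi>_def config_space_def using assms(3) by (intro measurable_restrict) simp
  have law: "field_law M X = distr M config_space \<Phi>"
    by (simp add: field_law_def \<Phi>_def)
  have \<Phi>_bond: "(\<lambda>w. \<Phi> w b) = X b" if "b \<in> bonds" for b
    using that by (simp add: \<Phi>_def)
  interpret prob_space M by fact
  interpret E: ergodic_environment "field_law M X" \<beta> m
  proof (intro ergodic_environment.intro ergodic_environment_axioms.intro)
    show "prob_space (field_law M X)" unfolding law by (rule prob_space_distr[OF \<Phi>])
    show "sets (field_law M X) = sets config_space" by (simp add: law)
    fix b :: "(int ^ 'd) set" assume b: "b \<in> bonds"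
    show "integrable (field_law M X) (\<lambda>\<xi>. \<xi> b)"
      unfolding law using assms(3)[OF b] \<Phi>_bond[OF b]
      by (simp add: integrable_distr_eq[OF \<Phi> measurable_coordinate[OF b]])
    show "(LINT \<xi>|field_law M X. \<xi> b) = m"
      unfolding law using assms(4)[OF b] \<Phi>_bond[OF b]
      by (simp add: integral_distr[OF \<Phi> measurable_coordinate[OF b]])
  qed fact+
  have \<Phi>_susceptibility: "quenched_susceptibility h \<beta> (\<Phi> w) x = quenched_susceptibility h \<beta> (\<lambda>b. X b w) x"
    for h w x by (intro quenched_susceptibility_cong) (simp add: \<Phi>_def)
  let ?hq = "Inf (ereal ` {h. E.finite_susceptibility h})"
  have "AE w in M. \<forall>x. quenched_critical_point \<beta> (\<Phi> w) x = ?hq"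
    using E.AE_quenched_critical_point unfolding law by (rule AE_distrD[OF \<Phi>])
  then have hq: "AE w in M. \<forall>x. quenched_critical_point \<beta> (\<lambda>b. X b w) x = ?hq"
    by (simp add: quenched_critical_point_def \<Phi>_susceptibility)
  have "(\<integral>\<^sup>+ \<xi>. quenched_susceptibility h \<beta> \<xi> x \<partial>field_law M X) =
      (\<integral>\<^sup>+ w. quenched_susceptibility h \<beta> (\<lambda>b. X b w) x \<partial>M)" for h x
    unfolding law by (simp add: nn_integral_distr \<Phi> measurable_quenched_susceptibility \<Phi>_susceptibility)
  then have upper: "?hq \<le> annealed_critical_point M \<beta> X x" for x
    using E.critical_point_bounds(2)[of x] by (simp add: annealed_critical_point_def)
  show ?thesis
  proof (intro conjI impI)
    show "\<exists>hq. AE w in M. \<forall>x. quenched_critical_point \<beta> (\<lambda>b. X b w) x = hq"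
      using hq by blast
    show "AE w in M. \<forall>x. ereal (h0 TYPE('d) - \<beta> * m) \<le> quenched_critical_point \<beta> (\<lambda>b. X b w) x \<and>
        quenched_critical_point \<beta> (\<lambda>b. X b w) x \<le> annealed_critical_point M \<beta> X x"
      using hq by eventually_elim (simp add: E.critical_point_bounds(1) upper)
    assume "CARD('d) = 1"
    then show "AE w in M. \<forall>x. quenched_critical_point \<beta> (\<lambda>b. X b w) x = ereal (h0 TYPE('d) - \<beta> * m)"
      using hq by (simp add: E.critical_point_bounds(3))
  qed
qed

end
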